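(* Let $G=(V,E,\omega)$ be a connected simple finite weighted graph with $V=\{1,\dots,n\}$, $(\mathbb V_l)_{l=1}^n$ a real vector, $(\mathbb W_{jl})_{1\le j,l\le n}$ a real symmetric matrix, $h>0$, and let the initial condition $\Psi^0=(\Psi^0_j)_{j=1}^n$ (a complex vector) satisfy $\sum_{j=1}^n|\Psi_j^0|^2=1$ and $|\Psi_j^0|>0$ for any $j\in V$. Then the system (GNLS) given in the context has a unique solution $\Psi(t)$ for all $t\in[0,\infty)$. Moreover, $\Psi(t)$ satisfies the following properties: (i) It conserves the total mass: $\sum_{j=1}^n|\Psi_j(t)|^2=1$. (ii) It conserves the total energy: $\mathcal E(\Psi(t))=\mathcal E(\Psi^0)$, where $\mathcal E(\Psi)=h^2\mathcal E_{kin}(\Psi)+\mathcal E_{pot}(\Psi)+\mathcal E_{int}(\Psi)$. (iii) It is time reversible: $\Psi(t)=\bar\Psi(-t)$, where the bar denotes complex conjugation. (iv) It is time transverse (gauge) invariant: denote by $\Psi^\alpha(t)$ the solution of (GNLS) with $\mathbb V^\alpha=(\mathbb V_j+\alpha)_{j=1}^n$ in place of $\mathbb V$, where $\alpha$ is a given real constant. Then $\Psi^\alpha(t)=\Psi(t)e^{i\frac{\alpha t}{h}}$. (v) If $\Psi^*(t)=\sqrt{\rho^*}\,e^{-i\nu t}$ satisfies (GNLS), where $\nu\in\mathbb R$ and $\rho^*=(\rho_j^* )_{j=1}^n\in\mathcal P_o(G)$ are time invariant, then $\rho^*$ is a critical point of the minimization problem $\min_{\rho\in\mathcal P(G)}\mathcal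 E(\sqrt\rho)$, and $$\nu=\mathcal E(\sqrt{\rho^*})+\mathcal E_{int}(\sqrt{\rho^*}).$$
   Context: $G$ is undirected, connected, without self-loops or multiple edges; $E$ is a set of ordered pairs containing both $(j,l)$ and $(l,j)$ for each edge; $\omega_{jl}=\omega_{lj}>0$ for $(j,l)\in E$; $N(j)=\{l:(j,l)\in E\}$. $\mathcal P(G)=\{\rho\in\mathbb R^n:\sum_j\rho_j=1,\rho_j\ge0\}$, with interior $\mathcal P_o(G)$ (all $\rho_j>0$). $g_{jl}(\rho)=\frac{\rho_j+\rho_l}2$. Discrete Fisher information: $\mathcal I(\rho)=\frac12\sum_{(j,l)\in E}\omega_{jl}(\log\rho_j-\log\rho_l)^2g_{jl}(\rho)$. (GNLS) is the system, for each $j\in V$, $$\frac{d\rho_j}{dt}+\sum_{l\in N(j)}\omega_{jl}(S_l-S_j)g_{jl}(\rho)=0,$$ $$\frac{dS_j}{dt}+\frac12\sum_{l\in N(j)}\omega_{jl}(S_j-S_l)^2\frac{\partial g_{jl}}{\partial\rho_j}+\frac{h^2}8\frac{\partial}{\partial\rho_j}\mathcal I(\rho)+\mathbb V_j+\sum_{l=1}^n\mathbb W_{jl}\rho_l=0,$$ for real unknowns $\rho(t)=(\rho_j(t))_j\in\mathcal P_o(G)$ and $S(t)=(S_j(t))_j\in\mathbb R^n$. It is not distinguished from its complex form: $\Psi(t)$ is a solution of (GNLS) when $\Psi_j(t)=\sqrt{\rho_j(t)}\,e^{iS_j(t)/h}$ with $(\rho,S)$ a solution, and then $\log\Psi_j$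 means $\frac12\log\rho_j+iS_j/h$. Energies: $$\mathcal E_{kin}(\Psi)=\frac14\sum_{(j,l)\in E}\omega_{jl}\{[\mathrm{Re}(\log\Psi_j-\log\Psi_l)]^2+[\mathrm{Im}(\log\Psi_j-\log\Psi_l)]^2\}g_{jl}(|\Psi|^2),$$ $\mathcal E_{pot}(\Psi)=\sum_{j}\mathbb V_j|\Psi_j|^2$, $\mathcal E_{int}(\Psi)=\frac12\sum_{j,l}\mathbb W_{jl}|\Psi_j|^2|\Psi_l|^2$, where $|\Psi|^2=(|\Psi_j|^2)_j$. Here $\sqrt\rho=(\sqrt{\rho_j})_j$, so $\mathcal E(\sqrt\rho)=\frac{h^2}8\mathcal I(\rho)+\sum_j\mathbb V_j\rho_j+\frac12\sum_{j,l}\mathbb W_{jl}\rho_j\rho_l$. A critical point of the minimization problem is a point satisfying its first-order (Karush–Kuhn–Tucker) conditions; for $\rho^*\in\mathcal P_o(G)$ this means that $\frac{\partial}{\partial\rho_j}\mathcal E(\sqrt\rho)|_{\rho^*}$ is independent of $j$.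
   Formalization: Corrected: in (iv) the factor is e^{-iαt/h}; in (v) hν, not ν, equals E+E_int. Uniqueness is for each choice of initial phase S(0) of Ψ^0 (Ψ^0 fixes it only mod 2πh). In (iii), Ψ(-t) is the backward solution starting from the conjugate datum with phase -S(0). *)

theory Defs
  imports "HOL-Analysis.Analysis"
begin

text \<open>The vertex set is the finite type \<open>'n\<close>; an undirected edge is the two ordered pairs
  \<open>(j, l)\<close>, \<open>(l, j)\<close> in \<open>E\<close>.\<close>

definition connected_weighted_graph ::
    "('n::finite \<times> 'n) set \<Rightarrow> ('n \<Rightarrow> 'n \<Rightarrow> real) \<Rightarrow> bool" where
  "connected_weighted_graph E \<omega> \<longleftrightarrow>
     sym E \<and> irrefl E \<and> (\<forall>j l. (j, l) \<in> E\<^sup>*) \<and>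
     (\<forall>(j, l) \<in> E. \<omega> j l = \<omega> l j \<and> 0 < \<omega> j l)"

definition nbrs :: "('n \<times> 'n) set \<Rightarrow> 'n \<Rightarrow> 'n set" where
  "nbrs E j = {l. (j, l) \<in> E}"

definition prob_simplex :: "(real ^ 'n::finite) set" where
  "prob_simplex = {\<rho>. (\<Sum>j\<in>UNIV. \<rho> $ j) = 1 \<and> (\<forall>j. 0 \<le> \<rho> $ j)}"

definition open_prob_simplex :: "(real ^ 'n::finite) set" where
  "open_prob_simplex = {\<rho>. (\<Sum>j\<in>UNIV. \<rho> $ j) = 1 \<and> (\<forall>j. 0 < \<rho> $ j)}"

definition edge_mean :: "'n \<Rightarrow> 'n \<Rightarrow> real ^ 'n::finite \<Rightarrow> real" where
  "edge_mean j l \<rho> = (\<rho> $ j + \<rho> $ l) / 2"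

definition fisher_information ::
    "('n::finite \<times> 'n) set \<Rightarrow> ('n \<Rightarrow> 'n \<Rightarrow> real) \<Rightarrow> real ^ 'n \<Rightarrow> real" where
  "fisher_information E \<omega> \<rho> =
     1 / 2 * (\<Sum>(j, l)\<in>E. \<omega> j l * (ln (\<rho> $ j) - ln (\<rho> $ l))\<^sup>2 * edge_mean j l \<rho>)"

text \<open>The \<open>j\<close>-th partial derivative. It is only meaningful where it exists, as it does below for
  \<open>edge_mean\<close> everywhere and for \<open>fisher_information\<close> at points with positive coordinates.\<close>

definition partial_deriv :: "'n \<Rightarrow> (real ^ 'n::finite \<Rightarrow> real) \<Rightarrow> real ^ 'n \<Rightarrow> real" where
  "partial_deriv j f x = deriv (\<lambda>s. f (x + s *\<^sub>R axis j 1)) 0"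

text \<open>Solutions on a time set \<open>J\<close>, with one-sided derivatives at an end point of \<open>J\<close>. Of the
  requirement that \<open>\<rho> t\<close> lie in the open simplex only positivity is built in, so that
  conservation of mass is not part of the definition; it follows from the first equation.\<close>

definition gnls_solution ::
    "real set \<Rightarrow> real \<Rightarrow> ('n::finite \<times> 'n) set \<Rightarrow> ('n \<Rightarrow> 'n \<Rightarrow> real) \<Rightarrow> real ^ 'n \<Rightarrow> real ^ 'n ^ 'n
      \<Rightarrow> (real \<Rightarrow> real ^ 'n) \<Rightarrow> (real \<Rightarrow> real ^ 'n) \<Rightarrow> bool" where
  "gnls_solution J h E \<omega> V W \<rho> S \<longleftrightarrow>
     (\<forall>t\<in>J. \<forall>j.
        0 < \<rho> t $ j \<and>
        ((\<lambda>s. \<rho> s $ j) has_real_derivative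
           - (\<Sum>l\<in>nbrs E j. \<omega> j l * (S t $ l - S t $ j) * edge_mean j l (\<rho> t)))
          (at t within J) \<and>
        ((\<lambda>s. S s $ j) has_real_derivative
           - (1 / 2 * (\<Sum>l\<in>nbrs E j. \<omega> j l * (S t $ j - S t $ l)\<^sup>2
                                        * partial_deriv j (edge_mean j l) (\<rho> t))
              + h\<^sup>2 / 8 * partial_deriv j (fisher_information E \<omega>) (\<rho> t)
              + V $ j + (\<Sum>l\<in>UNIV. W $ j $ l * \<rho> t $ l)))
          (at t within J))"

text \<open>The solution on \<open>J\<close> with the given data at time \<open>0\<close>, for \<open>J\<close> containing \<open>0\<close>.\<close>

definition unique_gnls_solution ::
    "real set \<Rightarrow> real \<Rightarrow> ('n::finite \<times> 'n) set \<Rightarrow> ('n \<Rightarrow> 'n \<Rightarrow> real) \<Rightarrow> real ^ 'n \<Rightarrow> real ^ 'n ^ 'n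
      \<Rightarrow> real ^ 'n \<Rightarrow> real ^ 'n \<Rightarrow> (real \<Rightarrow> real ^ 'n) \<Rightarrow> (real \<Rightarrow> real ^ 'n) \<Rightarrow> bool" where
  "unique_gnls_solution J h E \<omega> V W \<rho>0 S0 \<rho> S \<longleftrightarrow>
     gnls_solution J h E \<omega> V W \<rho> S \<and> \<rho> 0 = \<rho>0 \<and> S 0 = S0 \<and>
     (\<forall>\<rho>' S'. gnls_solution J h E \<omega> V W \<rho>' S' \<and> \<rho>' 0 = \<rho>0 \<and> S' 0 = S0 \<longrightarrow>
        (\<forall>t\<in>J. \<rho>' t = \<rho> t \<and> S' t = S t))"

definition wave :: "real \<Rightarrow> real ^ 'n::finite \<Rightarrow> real ^ 'n \<Rightarrow> complex ^ 'n" where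
  "wave h \<rho> S = (\<chi> j. complex_of_real (sqrt (\<rho> $ j)) * exp (\<i> * of_real (S $ j / h)))"

definition log_wave :: "real \<Rightarrow> real ^ 'n::finite \<Rightarrow> real ^ 'n \<Rightarrow> complex ^ 'n" where
  "log_wave h \<rho> S = (\<chi> j. of_real (ln (\<rho> $ j) / 2) + \<i> * of_real (S $ j / h))"

definition density :: "complex ^ 'n::finite \<Rightarrow> real ^ 'n" where
  "density \<Psi> = (\<chi> j. (cmod (\<Psi> $ j))\<^sup>2)"

definition gnls_wave_solution ::
    "real set \<Rightarrow> real \<Rightarrow> ('n::finite \<times> 'n) set \<Rightarrow> ('n \<Rightarrow> 'n \<Rightarrow> real) \<Rightarrow> real ^ 'n \<Rightarrow> real ^ 'n ^ 'n
      \<Rightarrow> (real \<Rightarrow> complex ^ 'n) \<Rightarrow> bool" where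
  "gnls_wave_solution J h E \<omega> V W \<Psi> \<longleftrightarrow>
     (\<exists>\<rho> S. gnls_solution J h E \<omega> V W \<rho> S \<and> (\<forall>t\<in>J. \<Psi> t = wave h (\<rho> t) (S t)))"

text \<open>The kinetic energy depends on the choice of \<open>log \<Psi>\<close>, because phase differences enter as real
  numbers and not modulo \<open>2 * pi\<close>. The logarithm \<open>L\<close> is therefore an explicit argument.\<close>

definition kinetic_energy ::
    "('n::finite \<times> 'n) set \<Rightarrow> ('n \<Rightarrow> 'n \<Rightarrow> real) \<Rightarrow> complex ^ 'n \<Rightarrow> complex ^ 'n \<Rightarrow> real" where
  "kinetic_energy E \<omega> L \<Psi> =
     1 / 4 * (\<Sum>(j, l)\<in>E. \<omega> j l * ((Re (L $ j - L $ l))\<^sup>2 + (Im (L $ j - L $ l))\<^sup>2)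
                              * edge_mean j l (density \<Psi>))"

definition potential_energy :: "real ^ 'n::finite \<Rightarrow> complex ^ 'n \<Rightarrow> real" where
  "potential_energy V \<Psi> = (\<Sum>j\<in>UNIV. V $ j * (cmod (\<Psi> $ j))\<^sup>2)"

definition interaction_energy :: "real ^ 'n ^ 'n::finite \<Rightarrow> complex ^ 'n \<Rightarrow> real" where
  "interaction_energy W \<Psi> =
     1 / 2 * (\<Sum>j\<in>UNIV. \<Sum>l\<in>UNIV. W $ j $ l * (cmod (\<Psi> $ j))\<^sup>2 * (cmod (\<Psi> $ l))\<^sup>2)"

definition total_energy ::
    "real \<Rightarrow> ('n::finite \<times> 'n) set \<Rightarrow> ('n \<Rightarrow> 'n \<Rightarrow> real) \<Rightarrow> real ^ 'n \<Rightarrow> real ^ 'n ^ 'n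
      \<Rightarrow> complex ^ 'n \<Rightarrow> complex ^ 'n \<Rightarrow> real" where
  "total_energy h E \<omega> V W L \<Psi> =
     h\<^sup>2 * kinetic_energy E \<omega> L \<Psi> + potential_energy V \<Psi> + interaction_energy W \<Psi>"

definition sqrt_state :: "real ^ 'n::finite \<Rightarrow> complex ^ 'n" where
  "sqrt_state \<rho> = (\<chi> j. of_real (sqrt (\<rho> $ j)))"

definition sqrt_energy ::
    "real \<Rightarrow> ('n::finite \<times> 'n) set \<Rightarrow> ('n \<Rightarrow> 'n \<Rightarrow> real) \<Rightarrow> real ^ 'n \<Rightarrow> real ^ 'n ^ 'n
      \<Rightarrow> real ^ 'n \<Rightarrow> real" where
  "sqrt_energy h E \<omega> V W \<rho> =
     total_energy h E \<omega> V W (\<chi> j. of_real (ln (sqrt (\<rho> $ j)))) (sqrt_state \<rho>)"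

text \<open>First-order (Karush-Kuhn-Tucker) conditions for minimizing \<open>F\<close> over \<open>prob_simplex\<close>, with
  multiplier \<open>\<kappa>\<close> for the mass constraint and \<open>\<mu>\<close> for the sign constraints. On
  \<open>open_prob_simplex\<close> complementary slackness gives \<open>\<mu> = 0\<close>, so all partial derivatives of \<open>F\<close>
  are then equal.\<close>

definition critical_point_on_simplex :: "(real ^ 'n::finite \<Rightarrow> real) \<Rightarrow> real ^ 'n \<Rightarrow> bool" where
  "critical_point_on_simplex F \<rho> \<longleftrightarrow>
     \<rho> \<in> prob_simplex \<and>
     (\<exists>\<kappa> \<mu>. \<forall>j. 0 \<le> \<mu> j \<and> \<mu> j * \<rho> $ j = 0 \<and>
        ((\<lambda>s. F (\<rho> + s *\<^sub>R axis j 1)) has_real_derivative \<kappa> + \<mu> j) (at 0))"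

end

theory Submission
  imports Defs
begin

text \<open>The system is Hamiltonian: with \<open>H(\<rho>, S) = \<E>(\<Psi>)\<close> it reads \<open>\<rho>' = \<partial>H/\<partial>S\<close>, \<open>S' = - \<partial>H/\<partial>\<rho>\<close>, so
  energy is conserved, and mass is conserved because the flux is antisymmetric along edges. Since the
  potential and interaction energies are bounded on the simplex, conservation bounds the Fisher
  information. The latter blows up at the boundary of the simplex of a connected graph, so the
  densities stay away from zero. The kinetic energy then bounds the phase differences along
  edges, hence also \<open>S'\<close>, and the phases grow at most linearly. These a priori bounds make the local
  solutions global. Time reversal and gauge invariance are symmetries of the equations and
  carry over by uniqueness. For a standing wave the continuity equation forces the phase differences
  along edges to vanish; the phase equation then says that \<open>h * \<nu>\<close> equals every partial derivative
  of the energy, and the formula for \<open>\<nu>\<close> is Euler's identity for homogeneous functions.\<close>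

section \<open>Ordinary differential equations\<close>

text \<open>The right-hand side is singular where a density vanishes, so a solution could end at the
  boundary of the simplex as well as at infinity. In the coordinates (ln \<rho>, S) the boundary
  lies at infinity too, and one norm bound excludes both. The energy sees the phases only through
  differences along edges and says nothing about a common phase; that is why S is bounded through
  S', with a bound that depends on the time horizon. The signs and factors in the statement follow
  from \<Psi> = sqrt \<rho> * exp (i S / h). Raising V by \<alpha> lowers S' by \<alpha>, which
  gives the factor exp (- i \<alpha> t / h). A wave rotating as exp (- i \<nu> t) has S' = - h
  \<nu>, so the energy formula is one for h \<nu>. At t = 0 time reversal reads \<Psi>(0) = cnj of
  the reversed state, so the backward solution starts from the conjugate datum, that is from -
  S0.\<close>

definition ode_solution :: "real set \<Rightarrow> ('a::real_normed_vector \<Rightarrow> 'a) \<Rightarrow> (real \<Rightarrow> 'a) \<Rightarrow> bool" where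
  "ode_solution J f x \<longleftrightarrow> (\<forall>t\<in>J. (x has_vector_derivative f (x t)) (at t within J))"

lemma ode_solution_subset: "ode_solution J f x \<Longrightarrow> I \<subseteq> J \<Longrightarrow> ode_solution I f x"
  unfolding ode_solution_def by (meson has_vector_derivative_within_subset subsetD)

lemma ode_solution_continuous: "ode_solution J f x \<Longrightarrow> continuous_on J x"
  unfolding ode_solution_def by (metis continuous_on_eq_continuous_within has_vector_derivative_continuous)

lemma within_atLeast_eq:
  fixes t T :: real
  assumes "0 \<le> t" "t < T"
  shows "at t within {0..T} = at t within {0..}"
  by (rule at_within_nhd[of _ "{..<T}"]) (use assms in auto)

text \<open>Integration from 0 gains a factor 1 / (2 K) in the norm weighted by exp (- 2 K t).
  Against a Lipschitz constant K this leaves 1/2, which is the origin of the rate 2 K.\<close>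

lemma exp_weighted_integral_bound:
  fixes \<phi> :: "real \<Rightarrow> 'a::banach"
  assumes K: "K > 0" and c: "continuous_on {0..t} \<phi>" and t: "0 \<le> t"
    and b: "\<And>s. 0 \<le> s \<Longrightarrow> s \<le> t \<Longrightarrow> norm (\<phi> s) \<le> B * exp (2 * K * s)"
  shows "exp (- (2 * K * t)) * norm (integral {0..t} \<phi>) \<le> B / (2 * K)"
proof -
  have B: "B \<ge> 0" using order_trans[OF norm_ge_zero b[of 0]] t by simp
  have i: "((\<lambda>s. B * exp (2 * K * s)) has_integral (B / (2 * K) * exp (2 * K * t) - B / (2 * K) * exp (2 * K * 0))) {0..t}"
    by (rule fundamental_theorem_of_calculus[OF t])
      (use K in \<open>auto intro!: derivative_eq_intros simp: has_real_derivative_iff_has_vector_derivative[symmetric]\<close>)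
  have "norm (integral {0..t} \<phi>) \<le> integral {0..t} (\<lambda>s. B * exp (2 * K * s))"
    by (rule integral_norm_bound_integral)
      (use b i c in \<open>auto simp: integrable_on_def[of "\<lambda>s. B * exp (2 * K * s)"] intro: integrable_continuous_real\<close>)
  also have "\<dots> = B / (2 * K) * exp (2 * K * t) - B / (2 * K)" using integral_unique[OF i] by simp
  also have "\<dots> \<le> B / (2 * K) * exp (2 * K * t)" using B K by simp
  finally have "exp (- (2 * K * t)) * norm (integral {0..t} \<phi>) \<le> exp (- (2 * K * t)) * (B / (2 * K) * exp (2 * K * t))"
    by (rule mult_left_mono) simp
  also have "\<dots> = B / (2 * K)" by (simp add: exp_minus)
  finally show ?thesis .
qed

text \<open>The weight \<open>exp (- (2 * K * t))\<close> makes the Picard map a contraction on the whole half-line at once.\<close>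

lemma lipschitz_ode_exists:
  fixes f :: "'a::banach \<Rightarrow> 'a"
  assumes "L-lipschitz_on UNIV f"
  shows "\<exists>x. x 0 = x0 \<and> ode_solution {0..} f x"
proof -
  \<comment> \<open>Adding 1 keeps \<open>K\<close> positive when \<open>L = 0\<close>, since
    \<open>K\<close> becomes a divisor.\<close>
  define K where "K = L + 1"
  have K: "K > 0" using lipschitz_on_nonneg[OF assms] K_def by simp
  have lip: "norm (f a - f b) \<le> K * norm (a - b)" for a b
  proof -
    have "norm (f a - f b) \<le> L * norm (a - b)"
      using lipschitz_onD[OF assms, of a b] by (simp add: dist_norm)
    also have "\<dots> \<le> K * norm (a - b)" unfolding K_def by (intro mult_right_mono) auto
    finally show ?thesis .
  qed
  have cf: "continuous_on UNIV f" by (rule lipschitz_on_continuous_on[OF assms])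
  \<comment> \<open>Here \<open>g\<close> plays the role of exp (- 2 K t) x(t): the solution may
    grow exponentially, but its rescaling is bounded and lives in the complete space of bounded
    continuous functions.\<close>
  define \<phi> where "\<phi> g s = f (exp (2 * K * s) *\<^sub>R apply_bcontfun g s)" for g :: "real \<Rightarrow>\<^sub>C 'a" and s
  have c\<phi>: "continuous_on A (\<phi> g)" for A g unfolding \<phi>_def
    by (rule continuous_on_compose2[OF cf]) (auto intro!: continuous_intros)
  define G where "G g t = exp (- (2 * K * t)) *\<^sub>R (x0 + integral {0..t} (\<phi> g))" for g t
  \<comment> \<open>Bounded continuous functions are defined on the whole line;
    \<open>max t 0\<close> extends the image by a constant to negative times.\<close>
  define T where "T g = Bcontfun (\<lambda>t. G g (max t 0))" for g
  have iv: "((\<lambda>t. integral {0..t} (\<phi> g)) has_vector_derivative \<phi> g t) (at t within {0..})" if "t \<ge> 0" for g t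
  proof -
    have "((\<lambda>t. integral {0..t} (\<phi> g)) has_vector_derivative \<phi> g t) (at t within {0..t+1})"
      by (rule integral_has_vector_derivative) (use that c\<phi> in auto)
    then show ?thesis using within_atLeast_eq[of t "t+1"] that by simp
  qed
  have ic: "continuous_on {0..} (\<lambda>t. integral {0..t} (\<phi> g))" for g
    using iv by (metis atLeast_iff continuous_on_eq_continuous_within has_vector_derivative_continuous)
  have Gc: "continuous_on UNIV (\<lambda>t. G g (max t 0))" for g
  proof (rule continuous_on_compose2[of "{0..}" "G g"])
    show "continuous_on {0..} (G g)" unfolding G_def by (intro continuous_intros ic)
  qed (auto intro!: continuous_intros)
  have Gb: "norm (G g t) \<le> norm x0 + (norm (f 0) + K * norm g) / (2 * K)" if t: "t \<ge> 0" for g t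
  proof -
    have "norm (\<phi> g s) \<le> (norm (f 0) + K * norm g) * exp (2 * K * s)" if "0 \<le> s" "s \<le> t" for s
    proof -
      have "norm (\<phi> g s) \<le> norm (f 0) + norm (\<phi> g s - f 0)" by (metis add.commute diff_add_cancel norm_triangle_ineq)
      also have "norm (\<phi> g s - f 0) \<le> K * (exp (2 * K * s) * norm (apply_bcontfun g s))"
        using lip[of "exp (2 * K * s) *\<^sub>R apply_bcontfun g s" 0] unfolding \<phi>_def by simp
      also have "\<dots> \<le> K * (exp (2 * K * s) * norm g)"
        using K norm_bounded[of g s] by (intro mult_left_mono) auto
      also have "norm (f 0) \<le> norm (f 0) * exp (2 * K * s)" using K that by (simp add: mult_le_cancel_left1)
      finally show ?thesis by (simp add: algebra_simps)
    qed
    from exp_weighted_integral_bound[OF K c\<phi> t this]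
    have 1: "exp (- (2 * K * t)) * norm (integral {0..t} (\<phi> g)) \<le> (norm (f 0) + K * norm g) / (2 * K)" .
    have "norm (G g t) \<le> exp (- (2 * K * t)) * (norm x0 + norm (integral {0..t} (\<phi> g)))"
      unfolding G_def by (simp add: norm_triangle_ineq)
    also have "\<dots> \<le> norm x0 + exp (- (2 * K * t)) * norm (integral {0..t} (\<phi> g))"
      using K t by (simp add: algebra_simps mult_left_le)
    finally show ?thesis using 1 by linarith
  qed
  have Tb: "(\<lambda>t. G g (max t 0)) \<in> bcontfun" for g
    by (rule bcontfun_normI[OF Gc Gb]) simp
  have Tv: "apply_bcontfun (T g) t = G g (max t 0)" for g t
    unfolding T_def using Bcontfun_inverse[OF Tb] by metis
  have contr: "dist (T g) (T k) \<le> 1/2 * dist g k" for g k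
  proof (rule dist_bound)
    fix t' :: real define t where "t = max t' 0"
    have t: "t \<ge> 0" unfolding t_def by simp
    have "norm (\<phi> g s - \<phi> k s) \<le> (K * dist g k) * exp (2 * K * s)" for s
    proof -
      have "norm (\<phi> g s - \<phi> k s) \<le> K * (exp (2 * K * s) * dist (apply_bcontfun g s) (apply_bcontfun k s))"
        using lip[of "exp (2 * K * s) *\<^sub>R apply_bcontfun g s" "exp (2 * K * s) *\<^sub>R apply_bcontfun k s"]
        unfolding \<phi>_def scaleR_diff_right[symmetric] by (simp add: dist_norm)
      also have "\<dots> \<le> K * (exp (2 * K * s) * dist g k)"
        using K dist_bounded[of g s k] by (intro mult_left_mono) auto
      finally show ?thesis by (simp add: algebra_simps)
    qed
    then have 1: "exp (- (2 * K * t)) * norm (integral {0..t} (\<lambda>s. \<phi> g s - \<phi> k s)) \<le> K * dist g k / (2 * K)"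
      by (intro exp_weighted_integral_bound[OF K _ t]) (auto intro!: continuous_intros c\<phi>)
    have "G g t - G k t = exp (- (2 * K * t)) *\<^sub>R (integral {0..t} (\<lambda>s. \<phi> g s - \<phi> k s))"
      unfolding G_def
      by (subst integral_diff) (auto intro: integrable_continuous_real c\<phi> simp: algebra_simps)
    then have "dist (G g t) (G k t) \<le> K * dist g k / (2 * K)" using 1 by (simp add: dist_norm)
    then show "dist (T g t') (T k t') \<le> 1/2 * dist g k" using K by (simp add: Tv t_def)
  qed
  obtain g where g: "T g = g"
    using banach_fix_type[of "1/2" T] contr by auto
  define x where "x t = x0 + integral {0..t} (\<phi> g)" for t
  have gx: "exp (2 * K * t) *\<^sub>R apply_bcontfun g t = x t" if "t \<ge> 0" for t
  proof -
    have "apply_bcontfun g t = exp (- (2 * K * t)) *\<^sub>R x t"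
      using Tv[of g t] that unfolding g G_def x_def by simp
    then show ?thesis by (simp flip: exp_add)
  qed
  have "(x has_vector_derivative f (x t)) (at t within {0..})" if "t \<ge> 0" for t
    using has_vector_derivative_add[OF has_vector_derivative_const iv[OF that], of x0 g] gx[OF that]
    by (simp add: \<phi>_def x_def[abs_def])
  moreover have "x 0 = x0" by (simp add: x_def)
  ultimately show ?thesis unfolding ode_solution_def by auto
qed

text \<open>Gronwall's argument: the squared distance of two solutions grows at rate at most 2 L, so
  exp (- 2 L s) times it is nonincreasing, and it starts at 0. Local Lipschitz constants suffice
  because both trajectories over a compact interval stay in one ball.\<close>

lemma ode_unique:
  fixes f :: "'a::euclidean_space \<Rightarrow> 'a"
  assumes lip: "\<And>R. \<exists>L. L-lipschitz_on (cball 0 R) f"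
    and x: "ode_solution {0..T} f x" and y: "ode_solution {0..T} f y"
    and 0: "x 0 = y 0" and t: "t \<in> {0..T}"
  shows "x t = y t"
proof -
  have "compact (x ` {0..T} \<union> y ` {0..T})"
    using ode_solution_continuous[OF x] ode_solution_continuous[OF y]
    by (intro compact_Un compact_continuous_image) auto
  then obtain R where R: "x ` {0..T} \<union> y ` {0..T} \<subseteq> cball 0 R"
    by (meson ball_subset_cball bounded_subset_ballD compact_imp_bounded subset_trans)
  obtain L where L: "L-lipschitz_on (cball 0 R) f" using lip by blast
  define z where "z s = exp (- (2 * L * s)) * ((x s - y s) \<bullet> (x s - y s))" for s
  define z' where "z' s = exp (- (2 * L * s)) * (2 * ((f (x s) - f (y s)) \<bullet> (x s - y s)) - 2 * L * ((x s - y s) \<bullet> (x s - y s)))" for s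
  have dz: "(z has_real_derivative z' s) (at s within {0..T})" if s: "s \<in> {0..T}" for s
  proof -
    have "((\<lambda>s. x s - y s) has_vector_derivative (f (x s) - f (y s))) (at s within {0..T})"
      using x y s unfolding ode_solution_def by (intro has_vector_derivative_diff) auto
    then have d: "((\<lambda>s. x s - y s) has_derivative (\<lambda>r. r *\<^sub>R (f (x s) - f (y s)))) (at s within {0..T})"
      by (simp add: has_vector_derivative_def)
    have i: "((\<lambda>s. (x s - y s) \<bullet> (x s - y s)) has_real_derivative
        2 * ((f (x s) - f (y s)) \<bullet> (x s - y s))) (at s within {0..T})"
      unfolding has_field_derivative_def
      by (rule has_derivative_eq_rhs[OF has_derivative_inner[OF d d]])
        (simp add: inner_commute[of "x s - y s"] fun_eq_iff)
    have e: "((\<lambda>s. exp (- (2 * L * s))) has_real_derivative - (2 * L) * exp (- (2 * L * s))) (at s within {0..T})"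
      by (auto intro!: derivative_eq_intros)
    show ?thesis unfolding z_def[abs_def] z'_def
      by (rule DERIV_cong[OF DERIV_mult'[OF e i]]) (simp add: algebra_simps)
  qed
  have z'0: "z' s \<le> 0" if s: "s \<in> {0..T}" for s
  proof -
    have "(f (x s) - f (y s)) \<bullet> (x s - y s) \<le> norm (f (x s) - f (y s)) * norm (x s - y s)"
      by (rule norm_cauchy_schwarz)
    also have "norm (f (x s) - f (y s)) \<le> L * norm (x s - y s)"
      using lipschitz_onD[OF L, of "x s" "y s"] R s by (auto simp: dist_norm image_subset_iff)
    finally have "(f (x s) - f (y s)) \<bullet> (x s - y s) \<le> L * ((x s - y s) \<bullet> (x s - y s))"
      by (simp add: power2_norm_eq_inner[symmetric] power2_eq_square mult_right_mono)
    then show ?thesis unfolding z'_def by (simp add: mult_le_0_iff)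
  qed
  have "z t \<le> z 0"
  proof (cases "0 < t")
    case True
    have "\<exists>\<xi>\<in>{0<..<t}. z t - z 0 = z' \<xi> * (t - 0)"
    proof (rule mvt_simple[OF True])
      fix s assume "0 \<le> s" "s \<le> t"
      then have "(z has_real_derivative z' s) (at s within {0..t})"
        using dz[of s] t by (auto intro: DERIV_subset)
      then show "(z has_derivative (*) (z' s)) (at s within {0..t})" by (simp add: has_field_derivative_def)
    qed
    then obtain \<xi> where "\<xi> \<in> {0<..<t}" "z t - z 0 = z' \<xi> * t" by auto
    then show ?thesis using z'0[of \<xi>] t mult_nonpos_nonneg[of "z' \<xi>" t] by auto
  qed (use t in auto)
  then have "(x t - y t) \<bullet> (x t - y t) \<le> 0" using 0 by (simp add: z_def mult_le_0_iff)
  then show ?thesis using inner_ge_zero[of "x t - y t"]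
    by (metis antisym inner_eq_zero_iff right_minus_eq)
qed

text \<open>The nearest-point projection onto a ball is nonexpansive, so \<open>f\<close> composed
  with it is Lipschitz everywhere. A solution of this truncated equation is genuine while it stays
  in the ball of radius \<open>R + 1\<close>, and the a priori bound \<open>R\<close> prevents it
  from reaching the sphere. The bound concerns only the end time \<open>\<tau>\<close>, but for
  every \<open>\<tau>\<close> up to \<open>T\<close>, so it applies at a first hitting time.\<close>

lemma ode_global_exists:
  fixes f :: "'a::euclidean_space \<Rightarrow> 'a"
  assumes lip: "\<And>R. \<exists>L. L-lipschitz_on (cball 0 R) f"
    and apriori: "\<And>T. \<exists>R. \<forall>\<tau> x. 0 \<le> \<tau> \<and> \<tau> \<le> T \<and> x 0 = x0 \<and> ode_solution {0..\<tau>} f x \<longrightarrow> norm (x \<tau>) \<le> R"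
  shows "\<exists>x. x 0 = x0 \<and> ode_solution {0..} f x"
proof -
  have ex: "\<exists>x. x 0 = x0 \<and> ode_solution {0..T} f x" if T: "T \<ge> 0" for T
  proof -
    obtain R where R: "\<And>\<tau> x. 0 \<le> \<tau> \<Longrightarrow> \<tau> \<le> T \<Longrightarrow> x 0 = x0 \<Longrightarrow> ode_solution {0..\<tau>} f x \<Longrightarrow> norm (x \<tau>) \<le> R"
      using apriori[of T] by blast
    define C :: "'a set" where "C = cball 0 (R+1)"
    \<comment> \<open>On the one-point interval every function is a solution, so the case \<tau> = 0
      of the bound applies to the initial value itself.\<close>
    have x0: "norm x0 \<le> R"
      using R[of 0 "\<lambda>_. x0"] T by (simp add: ode_solution_def has_vector_derivative_def has_derivative_within_singleton_iff bounded_linear_scaleR_left)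
    then have R0: "R \<ge> 0" using norm_ge_zero[of x0] by linarith
    have C: "convex C" "closed C" "C \<noteq> {}" unfolding C_def using R0 by auto
    obtain L where L: "L-lipschitz_on C f" unfolding C_def using lip by blast
    have "L-lipschitz_on UNIV (\<lambda>x. f (closest_point C x))"
    proof (rule lipschitz_onI)
      fix a b
      have "dist (f (closest_point C a)) (f (closest_point C b)) \<le> L * dist (closest_point C a) (closest_point C b)"
        by (rule lipschitz_onD[OF L]) (use C closest_point_in_set in auto)
      also have "\<dots> \<le> L * dist a b"
        by (intro mult_left_mono closest_point_lipschitz C lipschitz_on_nonneg[OF L])
      finally show "dist (f (closest_point C a)) (f (closest_point C b)) \<le> L * dist a b" .
    qed (rule lipschitz_on_nonneg[OF L])
    then obtain y where y0: "y 0 = x0" and y: "ode_solution {0..} (\<lambda>x. f (closest_point C x)) y"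
      using lipschitz_ode_exists by blast
    have yf: "ode_solution {0..\<tau>} f y" if "\<And>s. 0 \<le> s \<Longrightarrow> s \<le> \<tau> \<Longrightarrow> norm (y s) \<le> R + 1" for \<tau>
    proof -
      have "ode_solution {0..\<tau>} (\<lambda>x. f (closest_point C x)) y" by (rule ode_solution_subset[OF y]) auto
      moreover have "closest_point C (y s) = y s" if "s \<in> {0..\<tau>}" for s
        using \<open>\<And>s. 0 \<le> s \<Longrightarrow> s \<le> \<tau> \<Longrightarrow> norm (y s) \<le> R + 1\<close>[of s] that
        by (intro closest_point_self) (auto simp: C_def)
      ultimately show ?thesis unfolding ode_solution_def by simp
    qed
    have yc: "continuous_on {0..} y" by (rule ode_solution_continuous[OF y])
    \<comment> \<open>The hitting times of the sphere form a compact set, which would have a least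
      element. Up to that time the truncation is inactive, so \<open>R\<close> bounds the norm
      there, although it equals \<open>R + 1\<close>.\<close>
    define B where "B = {s \<in> {0..T}. norm (y s) = R + 1}"
    have "B = {}"
    proof (rule ccontr)
      assume "B \<noteq> {}"
      have "closed B" unfolding B_def
        by (rule continuous_closed_preimage_constant) (auto intro!: continuous_intros continuous_on_subset[OF yc])
      moreover have "bounded B" by (rule bounded_subset[of "{0..T}"]) (auto simp: B_def)
      ultimately have "compact B" by (simp add: compact_eq_bounded_closed)
      then obtain \<tau> where \<tau>: "\<tau> \<in> B" and min: "\<And>s. s \<in> B \<Longrightarrow> \<tau> \<le> s"
        using compact_attains_inf[OF _ \<open>B \<noteq> {}\<close>] by metis
      have "norm (y s) \<le> R + 1" if s: "0 \<le> s" "s \<le> \<tau>" for s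
      proof (rule ccontr)
        assume "\<not> norm (y s) \<le> R + 1"
        then obtain r where r: "0 \<le> r" "r \<le> s" "norm (y r) = R + 1"
          using IVT'[of "\<lambda>s. norm (y s)" 0 "R+1" s] s x0 y0
          by (force intro!: continuous_intros continuous_on_subset[OF yc])
        then have "r \<in> B" using s \<tau> by (auto simp: B_def)
        from min[OF this] r s have "s = r" by simp
        then show False using r \<open>\<not> norm (y s) \<le> R + 1\<close> by simp
      qed
      then have "norm (y \<tau>) \<le> R" using \<tau> by (intro R yf y0) (auto simp: B_def)
      then show False using \<tau> by (simp add: B_def)
    qed
    have "norm (y s) \<le> R + 1" if s: "0 \<le> s" "s \<le> T" for s
    proof (rule ccontr)
      assume "\<not> norm (y s) \<le> R + 1"
      then obtain r where r: "0 \<le> r" "r \<le> s" "norm (y r) = R + 1"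
        using IVT'[of "\<lambda>s. norm (y s)" 0 "R+1" s] s x0 y0
        by (force intro!: continuous_intros continuous_on_subset[OF yc])
      then show False using \<open>B = {}\<close> s by (auto simp: B_def)
    qed
    then show ?thesis using yf y0 by blast
  qed
  define Y where "Y N = (SOME x. x 0 = x0 \<and> ode_solution {0..real N} f x)" for N
  have Y: "Y N 0 = x0 \<and> ode_solution {0..real N} f (Y N)" for N
    unfolding Y_def using someI_ex[OF ex[of "real N"]] by simp
  have YY: "Y N t = Y M t" if "0 \<le> t" "t \<le> N" "t \<le> M" for N M :: nat and t :: real
  proof (rule ode_unique[OF lip, of "min N M"])
    show "ode_solution {0..real (min N M)} f (Y N)"
      by (rule ode_solution_subset[of "{0..real N}"]) (use Y in auto)
    show "ode_solution {0..real (min N M)} f (Y M)"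
      by (rule ode_solution_subset[of "{0..real M}"]) (use Y in auto)
  qed (use Y that in auto)
  define x where "x t = Y (nat \<lceil>t\<rceil>) t" for t
  have xY: "x t = Y N t" if "0 \<le> t" "t \<le> N" for t N
    unfolding x_def by (rule YY) (use that in auto)
  have "(x has_vector_derivative f (x t)) (at t within {0..})" if t: "t \<ge> 0" for t
  proof -
    \<comment> \<open>The strict inequality matters: \<open>t\<close> must not be the right end
      point of \<open>{0..N}\<close>, where the derivative would be one-sided from the left
      only.\<close>
    obtain N :: nat where N: "t < N" using reals_Archimedean2 by blast
    have "(Y N has_vector_derivative f (Y N t)) (at t within {0..real N})"
      using Y[of N] N t by (auto simp: ode_solution_def)
    moreover have e: "x t = Y N t" using xY[of t N] N t by simp
    ultimately have "(x has_vector_derivative f (x t)) (at t within {0..real N})"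
      unfolding e using N t xY by (intro has_vector_derivative_transform[of t _ x "Y N"]) auto
    then show ?thesis using within_atLeast_eq[OF t N] by simp
  qed
  moreover have "x 0 = x0" using xY[of 0 0] Y by simp
  ultimately show ?thesis unfolding ode_solution_def by auto
qed

section \<open>Calculus of bounded Lipschitz functions\<close>

text \<open>Lipschitz functions are closed under products only together with boundedness, so both
  properties travel as one. This lets the Lipschitz property of a compound expression be read off
  from its syntax.\<close>

definition bounded_lipschitz :: "'a::metric_space set \<Rightarrow> ('a \<Rightarrow> real) \<Rightarrow> bool" where
  "bounded_lipschitz X f \<longleftrightarrow>
     (\<exists>B\<ge>0. (\<forall>x\<in>X. \<bar>f x\<bar> \<le> B) \<and> (\<forall>x\<in>X. \<forall>y\<in>X. \<bar>f x - f y\<bar> \<le> B * dist x y))"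

lemma bounded_lipschitz_const: "bounded_lipschitz X (\<lambda>_. c)"
  unfolding bounded_lipschitz_def by (rule exI[of _ "\<bar>c\<bar>"]) auto

lemma bounded_lipschitz_add:
  assumes "bounded_lipschitz X f" "bounded_lipschitz X g"
  shows "bounded_lipschitz X (\<lambda>x. f x + g x)"
proof -
  obtain B C where B: "B \<ge> 0" "\<And>x. x \<in> X \<Longrightarrow> \<bar>f x\<bar> \<le> B" "\<And>x y. x \<in> X \<Longrightarrow> y \<in> X \<Longrightarrow> \<bar>f x - f y\<bar> \<le> B * dist x y"
    and C: "C \<ge> 0" "\<And>x. x \<in> X \<Longrightarrow> \<bar>g x\<bar> \<le> C" "\<And>x y. x \<in> X \<Longrightarrow> y \<in> X \<Longrightarrow> \<bar>g x - g y\<bar> \<le> C * dist x y"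
    using assms unfolding bounded_lipschitz_def by metis
  show ?thesis unfolding bounded_lipschitz_def
  proof (intro exI[of _ "B + C"] conjI ballI)
    fix x y assume x: "x \<in> X" and y: "y \<in> X"
    show "\<bar>f x + g x - (f y + g y)\<bar> \<le> (B + C) * dist x y"
      using B(3)[OF x y] C(3)[OF x y] by (simp add: algebra_simps)
  next
    fix x assume x: "x \<in> X" show "\<bar>f x + g x\<bar> \<le> B + C" using B(2)[OF x] C(2)[OF x] by simp
  qed (use B C in auto)
qed

lemma bounded_lipschitz_mult:
  assumes "bounded_lipschitz X f" "bounded_lipschitz X g"
  shows "bounded_lipschitz X (\<lambda>x. f x * g x)"
proof -
  obtain B C where B: "B \<ge> 0" "\<And>x. x \<in> X \<Longrightarrow> \<bar>f x\<bar> \<le> B" "\<And>x y. x \<in> X \<Longrightarrow> y \<in> X \<Longrightarrow> \<bar>f x - f y\<bar> \<le> B * dist x y"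
    and C: "C \<ge> 0" "\<And>x. x \<in> X \<Longrightarrow> \<bar>g x\<bar> \<le> C" "\<And>x y. x \<in> X \<Longrightarrow> y \<in> X \<Longrightarrow> \<bar>g x - g y\<bar> \<le> C * dist x y"
    using assms unfolding bounded_lipschitz_def by metis
  show ?thesis unfolding bounded_lipschitz_def
  proof (intro exI[of _ "2 * (B * C)"] conjI ballI)
    fix x y assume x: "x \<in> X" and y: "y \<in> X"
    have "\<bar>f x * g x - f y * g y\<bar> = \<bar>f x * (g x - g y) + g y * (f x - f y)\<bar>" by (simp add: algebra_simps)
    also have "\<dots> \<le> \<bar>f x\<bar> * \<bar>g x - g y\<bar> + \<bar>g y\<bar> * \<bar>f x - f y\<bar>"
      by (metis abs_mult abs_triangle_ineq)
    also have "\<dots> \<le> B * (C * dist x y) + C * (B * dist x y)"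
      using B(1) C(1) B(2)[OF x] C(2)[OF y] B(3)[OF x y] C(3)[OF x y] by (intro add_mono mult_mono) auto
    finally show "\<bar>f x * g x - f y * g y\<bar> \<le> 2 * (B * C) * dist x y" by (simp add: algebra_simps)
  next
    fix x assume x: "x \<in> X"
    have "\<bar>f x\<bar> * \<bar>g x\<bar> \<le> B * C" using B(1) B(2)[OF x] C(2)[OF x] by (intro mult_mono) auto
    then show "\<bar>f x * g x\<bar> \<le> 2 * (B * C)" unfolding abs_mult using B(1) C(1) by (smt (verit) mult_nonneg_nonneg)
  qed (use B C in auto)
qed

lemma bounded_lipschitz_uminus: "bounded_lipschitz X f \<Longrightarrow> bounded_lipschitz X (\<lambda>x. - f x)"
  using bounded_lipschitz_mult[OF bounded_lipschitz_const[of X "-1"]] by simp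

lemma bounded_lipschitz_diff:
  "bounded_lipschitz X f \<Longrightarrow> bounded_lipschitz X g \<Longrightarrow> bounded_lipschitz X (\<lambda>x. f x - g x)"
  using bounded_lipschitz_add[OF _ bounded_lipschitz_uminus] by fastforce

lemma bounded_lipschitz_divide: "bounded_lipschitz X f \<Longrightarrow> bounded_lipschitz X (\<lambda>x. f x / c)"
  using bounded_lipschitz_mult[OF _ bounded_lipschitz_const[of X "1 / c"]] by simp

lemma bounded_lipschitz_power2: "bounded_lipschitz X f \<Longrightarrow> bounded_lipschitz X (\<lambda>x. (f x)\<^sup>2)"
  unfolding power2_eq_square by (rule bounded_lipschitz_mult)

lemma bounded_lipschitz_sum:
  assumes "finite I" "\<And>i. i \<in> I \<Longrightarrow> bounded_lipschitz X (f i)"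
  shows "bounded_lipschitz X (\<lambda>x. \<Sum>i\<in>I. f i x)"
  using assms by (induction I rule: finite_induct) (auto intro: bounded_lipschitz_const bounded_lipschitz_add)

lemma abs_exp_diff_le:
  fixes a b :: real
  assumes "a \<le> B" "b \<le> B"
  shows "\<bar>exp a - exp b\<bar> \<le> exp B * \<bar>a - b\<bar>"
proof -
  have *: "exp y - exp x \<le> exp B * (y - x)" if "x \<le> y" "y \<le> B" for x y :: real
  proof -
    have "exp y - exp x = exp y * (1 - exp (x - y))" by (simp add: algebra_simps exp_diff)
    also have "\<dots> \<le> exp B * (y - x)"
      using that exp_ge_add_one_self[of "x - y"] by (intro mult_mono) (simp_all del: exp_ge_add_one_self add: algebra_simps)
    finally show ?thesis .
  qed
  show ?thesis using *[of a b] *[of b a] assms by (cases "a \<le> b") auto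
qed

lemma bounded_lipschitz_exp:
  assumes "bounded_lipschitz X f"
  shows "bounded_lipschitz X (\<lambda>x. exp (f x))"
proof -
  obtain B where B: "B \<ge> 0" "\<And>x. x \<in> X \<Longrightarrow> \<bar>f x\<bar> \<le> B" "\<And>x y. x \<in> X \<Longrightarrow> y \<in> X \<Longrightarrow> \<bar>f x - f y\<bar> \<le> B * dist x y"
    using assms unfolding bounded_lipschitz_def by metis
  show ?thesis unfolding bounded_lipschitz_def
  \<comment> \<open>One constant has to serve twice: exp B bounds the values, exp B times B the
    difference quotients.\<close>
  proof (intro exI[of _ "exp B * (B + 1)"] conjI ballI)
    fix x y assume x: "x \<in> X" and y: "y \<in> X"
    have "\<bar>exp (f x) - exp (f y)\<bar> \<le> exp B * \<bar>f x - f y\<bar>"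
      using abs_exp_diff_le B(2)[OF x] B(2)[OF y] abs_le_D1 by blast
    also have "\<dots> \<le> exp B * ((B + 1) * dist x y)"
      using B(3)[OF x y] by (intro mult_left_mono) (auto intro: order_trans simp: distrib_right)
    finally show "\<bar>exp (f x) - exp (f y)\<bar> \<le> exp B * (B + 1) * dist x y" by (simp add: algebra_simps)
  next
    fix x assume x: "x \<in> X"
    have "\<bar>exp (f x)\<bar> \<le> exp B * 1" using B(2)[OF x] by simp
    also have "\<dots> \<le> exp B * (B + 1)" using B(1) by (intro mult_left_mono) auto
    finally show "\<bar>exp (f x)\<bar> \<le> exp B * (B + 1)" .
  qed (use B in auto)
qed

lemma bounded_lipschitz_linear:
  fixes f :: "'a::real_normed_vector \<Rightarrow> real"
  assumes f: "bounded_linear f" and X: "bounded X"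
  shows "bounded_lipschitz X f"
proof -
  obtain K where K: "K > 0" "\<And>x. norm (f x) \<le> norm x * K"
    using bounded_linear.pos_bounded[OF f] by blast
  obtain R where R: "R > 0" "\<And>x. x \<in> X \<Longrightarrow> norm x \<le> R" using X unfolding bounded_pos by blast
  show ?thesis unfolding bounded_lipschitz_def
  proof (intro exI[of _ "(R + 1) * K"] conjI ballI)
    fix x assume "x \<in> X"
    have "norm (f x) \<le> norm x * K" by (rule K)
    also have "\<dots> \<le> (R + 1) * K" using R(2)[OF \<open>x \<in> X\<close>] K by (intro mult_right_mono) auto
    finally show "\<bar>f x\<bar> \<le> (R + 1) * K" by simp
  next
    fix x y
    have "norm (f (x - y)) \<le> norm (x - y) * K" by (rule K)
    also have "\<dots> \<le> (R + 1) * (K * norm (x - y))"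
      using K(1) R(1) by (simp add: algebra_simps)
    finally show "\<bar>f x - f y\<bar> \<le> (R + 1) * K * dist x y"
      by (simp add: linear_diff[OF bounded_linear.linear[OF f]] dist_norm mult.assoc)
  qed (use K R in auto)
qed

text \<open>The Euclidean norm is at most the sum of the absolute coordinates, so the constants of
  all coordinates may simply be added.\<close>

lemma lipschitz_on_pair_of_vec:
  fixes f g :: "'a::metric_space \<Rightarrow> 'n::finite \<Rightarrow> real"
  assumes f: "\<And>j. bounded_lipschitz X (\<lambda>x. f x j)" and g: "\<And>j. bounded_lipschitz X (\<lambda>x. g x j)"
  shows "\<exists>L. L-lipschitz_on X (\<lambda>x. (\<chi> j. f x j, \<chi> j. g x j) :: (real ^ 'n) \<times> (real ^ 'n))"
proof -
  from f obtain B where B: "\<And>j. B j \<ge> 0" "\<And>j x y. x \<in> X \<Longrightarrow> y \<in> X \<Longrightarrow> \<bar>f x j - f y j\<bar> \<le> B j * dist x y"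
    unfolding bounded_lipschitz_def by metis
  from g obtain C where C: "\<And>j. C j \<ge> 0" "\<And>j x y. x \<in> X \<Longrightarrow> y \<in> X \<Longrightarrow> \<bar>g x j - g y j\<bar> \<le> C j * dist x y"
    unfolding bounded_lipschitz_def by metis
  have "(sum B UNIV + sum C UNIV)-lipschitz_on X (\<lambda>x. (\<chi> j. f x j, \<chi> j. g x j) :: (real ^ 'n) \<times> (real ^ 'n))"
  proof (rule lipschitz_onI)
    fix x y assume x: "x \<in> X" and y: "y \<in> X"
    have "dist ((\<chi> j. f x j, \<chi> j. g x j) :: (real ^ 'n) \<times> (real ^ 'n)) (\<chi> j. f y j, \<chi> j. g y j)
        \<le> dist (\<chi> j. f x j) (\<chi> j. f y j) + dist (\<chi> j. g x j) (\<chi> j. g y j)"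
      unfolding dist_Pair_Pair by (rule sqrt_sum_squares_le_sum) auto
    also have "dist (\<chi> j. f x j) (\<chi> j. f y j) \<le> (\<Sum>j\<in>UNIV. \<bar>f x j - f y j\<bar>)"
      unfolding dist_norm by (rule order_trans[OF norm_le_l1_cart]) simp
    also have "\<dots> \<le> (\<Sum>j\<in>UNIV. B j * dist x y)" by (intro sum_mono B x y)
    also have "dist (\<chi> j. g x j) (\<chi> j. g y j) \<le> (\<Sum>j\<in>UNIV. \<bar>g x j - g y j\<bar>)"
      unfolding dist_norm by (rule order_trans[OF norm_le_l1_cart]) simp
    also have "\<dots> \<le> (\<Sum>j\<in>UNIV. C j * dist x y)" by (intro sum_mono C x y)
    finally show "dist ((\<chi> j. f x j, \<chi> j. g x j) :: (real ^ 'n) \<times> (real ^ 'n)) (\<chi> j. f y j, \<chi> j. g y j)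
        \<le> (sum B UNIV + sum C UNIV) * dist x y"
      by (simp add: sum_distrib_right distrib_right)
  qed (use B C in \<open>auto intro!: add_nonneg_nonneg sum_nonneg\<close>)
  then show ?thesis by blast
qed

lemma has_vector_derivative_vecI:
  fixes f :: "real \<Rightarrow> real ^ 'n::finite"
  assumes "\<And>j. ((\<lambda>s. f s $ j) has_real_derivative D $ j) (at t within J)"
  shows "(f has_vector_derivative D) (at t within J)"
  unfolding has_vector_derivative_def
proof (subst has_derivative_componentwise_within, intro ballI)
  fix i :: "real ^ 'n" assume "i \<in> Basis"
  then obtain j where i: "i = axis j 1" by (auto simp: Basis_vec_def)
  show "((\<lambda>s. f s \<bullet> i) has_derivative (\<lambda>x. (x *\<^sub>R D) \<bullet> i)) (at t within J)"
    using assms[of j] unfolding i has_field_derivative_def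
    by (simp add: inner_axis mult.commute[of _ "D $ j"] del: inner_scaleR_left)
qed

lemma has_real_derivative_vec_nth:
  fixes f :: "real \<Rightarrow> real ^ 'n::finite"
  assumes "(f has_vector_derivative D) (at t within J)"
  shows "((\<lambda>s. f s $ j) has_real_derivative D $ j) (at t within J)"
  unfolding has_real_derivative_iff_has_vector_derivative
  by (rule bounded_linear.has_vector_derivative[OF bounded_linear_vec_nth assms])

section \<open>Hamiltonian structure and conservation laws\<close>

lemma unique_gnls_solutionI:
  assumes "gnls_solution J h E \<omega> V W \<rho> S" "\<rho> 0 = \<rho>0" "S 0 = S0"
    and "\<And>\<rho>' S' t. gnls_solution J h E \<omega> V W \<rho>' S' \<Longrightarrow> \<rho>' 0 = \<rho>0 \<Longrightarrow> S' 0 = S0 \<Longrightarrow> t \<in> J \<Longrightarrow>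
      \<rho>' t = \<rho> t \<and> S' t = S t"
  shows "unique_gnls_solution J h E \<omega> V W \<rho>0 S0 \<rho> S"
  using assms unfolding unique_gnls_solution_def by blast

lemma unique_gnls_solutionD:
  assumes "unique_gnls_solution J h E \<omega> V W \<rho>0 S0 \<rho> S"
  shows "gnls_solution J h E \<omega> V W \<rho> S" "\<rho> 0 = \<rho>0" "S 0 = S0"
    and "\<And>\<rho>' S' t. gnls_solution J h E \<omega> V W \<rho>' S' \<Longrightarrow> \<rho>' 0 = \<rho>0 \<Longrightarrow> S' 0 = S0 \<Longrightarrow> t \<in> J \<Longrightarrow>
      \<rho>' t = \<rho> t \<and> S' t = S t"
  using assms unfolding unique_gnls_solution_def by blast+

text \<open>The potential \<open>V\<close> stays a parameter of the individual lemmas, because the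
  gauge transformation relates solutions for two different potentials.\<close>

locale gnls_graph =
  fixes E :: "('n::finite \<times> 'n) set" and \<omega> :: "'n \<Rightarrow> 'n \<Rightarrow> real"
    and W :: "real ^ 'n ^ 'n" and h :: real
  assumes graph: "connected_weighted_graph E \<omega>"
    and W_sym: "transpose W = W"
    and h_pos: "h > 0"
begin

text \<open>Extending \<omega> by zero turns sums over neighbours and edges into full double sums,
  where the order of summation can be exchanged freely.\<close>

definition weight :: "'n \<Rightarrow> 'n \<Rightarrow> real" where
  "weight j l = (if (j, l) \<in> E then \<omega> j l else 0)"

lemma weight_sym: "weight j l = weight l j"
  using graph unfolding weight_def connected_weighted_graph_def sym_def by auto

lemma weight_nonneg: "weight j l \<ge> 0"
  using graph unfolding weight_def connected_weighted_graph_def by force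

lemma weight_pos: "(j, l) \<in> E \<Longrightarrow> weight j l > 0"
  using graph unfolding weight_def connected_weighted_graph_def by force

lemma W_swap: "W $ j $ l = W $ l $ j"
  using W_sym by (metis transpose_def vec_lambda_beta)

lemma sum_nbrs: "(\<Sum>l\<in>nbrs E j. \<omega> j l * X l) = (\<Sum>l\<in>UNIV. weight j l * X l)"
  by (rule sum.mono_neutral_cong_left) (auto simp: nbrs_def weight_def)

lemma sum_edges: "(\<Sum>(j, l)\<in>E. \<omega> j l * X j l) = (\<Sum>j\<in>UNIV. \<Sum>l\<in>UNIV. weight j l * X j l)"
  unfolding sum.cartesian_product
  by (rule sum.mono_neutral_cong_left) (auto simp: weight_def)

text \<open>Summation by parts on the graph. It collects the two end-point contributions of each
  edge at a single vertex; the gradients, Euler's identity and the rigidity of standing waves all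
  rest on it.\<close>

lemma sum_weight_symmetrize:
  fixes A :: "'n \<Rightarrow> 'n \<Rightarrow> real"
  shows "(\<Sum>j\<in>UNIV. \<Sum>l\<in>UNIV. weight j l * (A j l * p j + A l j * p l))
       = 2 * (\<Sum>j\<in>UNIV. (\<Sum>l\<in>UNIV. weight j l * A j l) * p j)"
proof -
  have "(\<Sum>j\<in>UNIV. \<Sum>l\<in>UNIV. weight j l * (A l j * p l)) = (\<Sum>j\<in>UNIV. \<Sum>l\<in>UNIV. weight j l * (A j l * p j))"
    by (subst sum.swap) (simp add: weight_sym)
  then show ?thesis
    by (simp add: distrib_left sum.distrib sum_distrib_right sum_distrib_left mult.assoc)
qed

lemma edge_irrefl: "(j, l) \<in> E \<Longrightarrow> j \<noteq> l"
  using graph unfolding connected_weighted_graph_def irrefl_def by blast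

text \<open>The gradient of the Fisher information. Its prefactor 1/2 cancels against each edge
  being counted in both directions, and (\<rho>_j + \<rho>_l) / \<rho>_j gives the factor 1 +
  \<rho>_l / \<rho>_j.\<close>

definition fisher_grad :: "real ^ 'n \<Rightarrow> 'n \<Rightarrow> real" where
  "fisher_grad \<rho> j = (\<Sum>l\<in>UNIV. weight j l *
     ((ln (\<rho> $ j) - ln (\<rho> $ l)) * (1 + \<rho> $ l / \<rho> $ j) + (ln (\<rho> $ j) - ln (\<rho> $ l))\<^sup>2 / 2))"

text \<open>\<open>flux\<close> is the derivative of the energy in S_j and \<open>force\<close> the
  one in \<rho>_j. The coefficient 1/4 in \<open>force\<close> is the 1/2 of the phase equation
  times the derivative 1/2 of the edge mean.\<close>

definition flux :: "real ^ 'n \<Rightarrow> real ^ 'n \<Rightarrow> 'n \<Rightarrow> real" where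
  "flux \<rho> S j = (\<Sum>l\<in>UNIV. weight j l * ((S $ j - S $ l) * ((\<rho> $ j + \<rho> $ l) / 2)))"

definition force :: "real ^ 'n \<Rightarrow> real ^ 'n \<Rightarrow> real ^ 'n \<Rightarrow> 'n \<Rightarrow> real" where
  "force V \<rho> S j = (\<Sum>l\<in>UNIV. weight j l * (S $ j - S $ l)\<^sup>2) / 4 + h\<^sup>2 / 8 * fisher_grad \<rho> j
     + V $ j + (\<Sum>l\<in>UNIV. W $ j $ l * \<rho> $ l)"

definition hamiltonian :: "real ^ 'n \<Rightarrow> real ^ 'n \<Rightarrow> real ^ 'n \<Rightarrow> real" where
  "hamiltonian V \<rho> S = (\<Sum>j\<in>UNIV. \<Sum>l\<in>UNIV. weight j l * ((S $ j - S $ l)\<^sup>2 * (\<rho> $ j + \<rho> $ l))) / 8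
     + h\<^sup>2 / 8 * fisher_information E \<omega> \<rho> + (\<Sum>j\<in>UNIV. V $ j * \<rho> $ j)
     + (\<Sum>j\<in>UNIV. \<Sum>l\<in>UNIV. W $ j $ l * (\<rho> $ j * \<rho> $ l)) / 2"

lemma fisher_information_eq:
  "fisher_information E \<omega> \<rho>
     = (\<Sum>j\<in>UNIV. \<Sum>l\<in>UNIV. weight j l * ((ln (\<rho> $ j) - ln (\<rho> $ l))\<^sup>2 * ((\<rho> $ j + \<rho> $ l) / 2))) / 2"
  using sum_edges[of "\<lambda>j l. (ln (\<rho> $ j) - ln (\<rho> $ l))\<^sup>2 * ((\<rho> $ j + \<rho> $ l) / 2)"]
  unfolding fisher_information_def edge_mean_def by (simp add: mult.assoc)

text \<open>Stated along a curve, the chain rule covers both uses at once: time derivatives along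
  solutions, and partial derivatives along coordinate lines.\<close>

lemma fisher_information_has_derivative:
  fixes r :: "real \<Rightarrow> real ^ 'n"
  assumes pos: "\<And>j. r t $ j > 0"
    and d: "\<And>j. ((\<lambda>s. r s $ j) has_real_derivative p j) (at t within J)"
  shows "((\<lambda>s. fisher_information E \<omega> (r s)) has_real_derivative
      (\<Sum>j\<in>UNIV. fisher_grad (r t) j * p j)) (at t within J)"
proof -
  define A where "A j l = (ln (r t $ j) - ln (r t $ l)) * (1 + r t $ l / r t $ j) + (ln (r t $ j) - ln (r t $ l))\<^sup>2 / 2" for j l
  have 1: "((\<lambda>s. (ln (r s $ j) - ln (r s $ l))\<^sup>2 * ((r s $ j + r s $ l) / 2)) has_real_derivative
      (A j l * p j + A l j * p l)) (at t within J)" for j l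
    using pos[of j] pos[of l] unfolding A_def
    by (auto intro!: derivative_eq_intros d simp: field_simps power2_eq_square)
  have "((\<lambda>s. fisher_information E \<omega> (r s)) has_real_derivative
      (\<Sum>j\<in>UNIV. \<Sum>l\<in>UNIV. weight j l * (A j l * p j + A l j * p l)) / 2) (at t within J)"
    unfolding fisher_information_eq by (intro DERIV_cdivide DERIV_sum DERIV_cmult 1)
  then show ?thesis unfolding sum_weight_symmetrize fisher_grad_def A_def by simp
qed

text \<open>With p = flux and q = - force the two products cancel, which is conservation of energy;
  with p a unit vector and q = 0 a partial derivative remains. The symmetry of W makes both factors
  of the interaction term contribute equally.\<close>

lemma hamiltonian_has_derivative:
  fixes r s :: "real \<Rightarrow> real ^ 'n"
  assumes pos: "\<And>j. r t $ j > 0"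
    and dr: "\<And>j. ((\<lambda>u. r u $ j) has_real_derivative p j) (at t within J)"
    and ds: "\<And>j. ((\<lambda>u. s u $ j) has_real_derivative q j) (at t within J)"
  shows "((\<lambda>u. hamiltonian V (r u) (s u)) has_real_derivative
      (\<Sum>j\<in>UNIV. force V (r t) (s t) j * p j + flux (r t) (s t) j * q j)) (at t within J)"
proof -
  define A where "A j l = (s t $ j - s t $ l) * (r t $ j + r t $ l)" for j l
  define B where "B j l = (s t $ j - s t $ l)\<^sup>2" for j l
  have "((\<lambda>u. (s u $ j - s u $ l)\<^sup>2 * (r u $ j + r u $ l)) has_real_derivative
      2 * (A j l * q j + A l j * q l) + (B j l * p j + B l j * p l)) (at t within J)" for j l
    unfolding A_def B_def
    by (auto intro!: derivative_eq_intros dr ds simp: algebra_simps power2_eq_square)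
  then have "((\<lambda>u. (\<Sum>j\<in>UNIV. \<Sum>l\<in>UNIV. weight j l * ((s u $ j - s u $ l)\<^sup>2 * (r u $ j + r u $ l))) / 8)
      has_real_derivative (\<Sum>j\<in>UNIV. \<Sum>l\<in>UNIV. weight j l * (2 * (A j l * q j + A l j * q l) + (B j l * p j + B l j * p l))) / 8) (at t within J)"
    by (intro DERIV_cdivide DERIV_sum DERIV_cmult)
  moreover have "(\<Sum>j\<in>UNIV. \<Sum>l\<in>UNIV. weight j l * (2 * (A j l * q j + A l j * q l) + (B j l * p j + B l j * p l))) / 8
      = (\<Sum>j\<in>UNIV. flux (r t) (s t) j * q j) + (\<Sum>j\<in>UNIV. (\<Sum>l\<in>UNIV. weight j l * B j l) / 4 * p j)"
  proof -
    have split: "(\<Sum>j\<in>UNIV. \<Sum>l\<in>UNIV. weight j l * (2 * (A j l * q j + A l j * q l) + (B j l * p j + B l j * p l)))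
       = 2 * (\<Sum>j\<in>UNIV. \<Sum>l\<in>UNIV. weight j l * (A j l * q j + A l j * q l))
         + (\<Sum>j\<in>UNIV. \<Sum>l\<in>UNIV. weight j l * (B j l * p j + B l j * p l))"
      by (simp add: distrib_left sum.distrib sum_distrib_left mult_ac)
    have "(\<Sum>l\<in>UNIV. weight j l * A j l) = 2 * flux (r t) (s t) j" for j
      unfolding flux_def A_def by (simp add: sum_distrib_left mult_ac)
    then have A: "(\<Sum>j\<in>UNIV. (\<Sum>l\<in>UNIV. weight j l * A j l) * q j) = 2 * (\<Sum>j\<in>UNIV. flux (r t) (s t) j * q j)"
      by (simp add: sum_distrib_left mult.assoc)
    have B: "(\<Sum>j\<in>UNIV. X j / 4 * p j) = (\<Sum>j\<in>UNIV. X j * p j) / 4" for X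
      by (simp add: sum_divide_distrib)
    show ?thesis unfolding split sum_weight_symmetrize A B by simp
  qed
  ultimately have kin: "((\<lambda>u. (\<Sum>j\<in>UNIV. \<Sum>l\<in>UNIV. weight j l * ((s u $ j - s u $ l)\<^sup>2 * (r u $ j + r u $ l))) / 8)
      has_real_derivative (\<Sum>j\<in>UNIV. flux (r t) (s t) j * q j) + (\<Sum>j\<in>UNIV. (\<Sum>l\<in>UNIV. weight j l * B j l) / 4 * p j)) (at t within J)"
    by (rule DERIV_cong)
  have fis: "((\<lambda>u. h\<^sup>2 / 8 * fisher_information E \<omega> (r u)) has_real_derivative
      h\<^sup>2 / 8 * (\<Sum>j\<in>UNIV. fisher_grad (r t) j * p j)) (at t within J)"
    by (intro DERIV_cmult fisher_information_has_derivative pos dr)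
  have pot: "((\<lambda>u. \<Sum>j\<in>UNIV. V $ j * r u $ j) has_real_derivative (\<Sum>j\<in>UNIV. V $ j * p j)) (at t within J)"
    by (intro DERIV_sum DERIV_cmult dr)
  have "((\<lambda>u. r u $ j * r u $ l) has_real_derivative (r t $ j * p l + p j * r t $ l)) (at t within J)" for j l
    by (rule DERIV_mult'[OF dr dr])
  then have "((\<lambda>u. (\<Sum>j\<in>UNIV. \<Sum>l\<in>UNIV. W $ j $ l * (r u $ j * r u $ l)) / 2) has_real_derivative
      (\<Sum>j\<in>UNIV. \<Sum>l\<in>UNIV. W $ j $ l * (r t $ j * p l + p j * r t $ l)) / 2) (at t within J)"
    by (intro DERIV_cdivide DERIV_sum DERIV_cmult)
  moreover have "(\<Sum>j\<in>UNIV. \<Sum>l\<in>UNIV. W $ j $ l * (r t $ j * p l + p j * r t $ l)) / 2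
      = (\<Sum>j\<in>UNIV. (\<Sum>l\<in>UNIV. W $ j $ l * r t $ l) * p j)"
  proof -
    have "(\<Sum>j\<in>UNIV. \<Sum>l\<in>UNIV. W $ j $ l * (r t $ j * p l)) = (\<Sum>j\<in>UNIV. \<Sum>l\<in>UNIV. W $ j $ l * (p j * r t $ l))"
      by (subst sum.swap) (simp add: W_swap mult_ac)
    then show ?thesis by (simp add: distrib_left sum.distrib sum_distrib_right sum_distrib_left mult_ac)
  qed
  ultimately have int: "((\<lambda>u. (\<Sum>j\<in>UNIV. \<Sum>l\<in>UNIV. W $ j $ l * (r u $ j * r u $ l)) / 2) has_real_derivative
      (\<Sum>j\<in>UNIV. (\<Sum>l\<in>UNIV. W $ j $ l * r t $ l) * p j)) (at t within J)"
    by (rule DERIV_cong)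
  show ?thesis unfolding hamiltonian_def
    by (rule DERIV_cong[OF DERIV_add[OF DERIV_add[OF DERIV_add[OF kin fis] pot] int]])
      (unfold sum_distrib_left[of "h\<^sup>2 / 8"] force_def B_def distrib_right sum.distrib mult.assoc, simp)
qed

lemma partial_deriv_fisher_information:
  assumes "\<And>j. \<rho> $ j > 0"
  shows "partial_deriv j (fisher_information E \<omega>) \<rho> = fisher_grad \<rho> j"
proof -
  have "((\<lambda>s. fisher_information E \<omega> (\<rho> + s *\<^sub>R axis j 1)) has_real_derivative
      (\<Sum>k\<in>UNIV. fisher_grad (\<rho> + 0 *\<^sub>R axis j 1) k * (axis j 1 $ k))) (at 0)"
    by (rule fisher_information_has_derivative) (use assms in \<open>auto intro!: derivative_eq_intros\<close>)
  also have "(\<Sum>k\<in>UNIV. fisher_grad (\<rho> + 0 *\<^sub>R axis j 1) k * (axis j 1 $ k)) = fisher_grad \<rho> j"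
    by (simp add: axis_def if_distrib cong: if_cong)
  finally show ?thesis unfolding partial_deriv_def by (rule DERIV_imp_deriv)
qed

text \<open>For j = l the derivative would be 1; edges join distinct vertices.\<close>

lemma partial_deriv_edge_mean:
  assumes "j \<noteq> l"
  shows "partial_deriv j (edge_mean j l) \<rho> = 1 / 2"
  unfolding partial_deriv_def edge_mean_def
  by (rule DERIV_imp_deriv) (use assms in \<open>auto simp: axis_def intro!: derivative_eq_intros\<close>)

lemma gnls_solution_iff:
  "gnls_solution J h E \<omega> V W \<rho> S \<longleftrightarrow> (\<forall>t\<in>J. \<forall>j. 0 < \<rho> t $ j \<and>
     ((\<lambda>s. \<rho> s $ j) has_real_derivative flux (\<rho> t) (S t) j) (at t within J) \<and>
     ((\<lambda>s. S s $ j) has_real_derivative - force V (\<rho> t) (S t) j) (at t within J))"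
proof -
  have 1: "- (\<Sum>l\<in>nbrs E j. \<omega> j l * (s $ l - s $ j) * edge_mean j l r) = flux r s j" for r s j
    unfolding flux_def edge_mean_def mult.assoc sum_nbrs sum_negf[symmetric]
    by (intro sum.cong refl) (simp add: field_simps)
  have 2: "1 / 2 * (\<Sum>l\<in>nbrs E j. \<omega> j l * (s $ j - s $ l)\<^sup>2 * partial_deriv j (edge_mean j l) r)
      + h\<^sup>2 / 8 * partial_deriv j (fisher_information E \<omega>) r
      + V $ j + (\<Sum>l\<in>UNIV. W $ j $ l * r $ l) = force V r s j" if "\<And>j. 0 < r $ j" for r s j
  proof -
    have "(\<Sum>l\<in>nbrs E j. \<omega> j l * (s $ j - s $ l)\<^sup>2 * partial_deriv j (edge_mean j l) r)
       = (\<Sum>l\<in>nbrs E j. \<omega> j l * ((s $ j - s $ l)\<^sup>2 / 2))"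
      by (rule sum.cong) (auto simp: nbrs_def partial_deriv_edge_mean edge_irrefl)
    also have "\<dots> = (\<Sum>l\<in>UNIV. weight j l * (s $ j - s $ l)\<^sup>2) / 2"
      unfolding sum_nbrs by (simp add: sum_divide_distrib)
    finally show ?thesis unfolding force_def by (simp add: partial_deriv_fisher_information that)
  qed
  show ?thesis unfolding gnls_solution_def 1
  proof (rule ball_cong[OF refl])
    fix t
    show "(\<forall>j. 0 < \<rho> t $ j \<and>
        ((\<lambda>s. \<rho> s $ j) has_real_derivative flux (\<rho> t) (S t) j) (at t within J) \<and>
        ((\<lambda>s. S s $ j) has_real_derivative
           - (1 / 2 * (\<Sum>l\<in>nbrs E j. \<omega> j l * (S t $ j - S t $ l)\<^sup>2 * partial_deriv j (edge_mean j l) (\<rho> t))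
              + h\<^sup>2 / 8 * partial_deriv j (fisher_information E \<omega>) (\<rho> t)
              + V $ j + (\<Sum>l\<in>UNIV. W $ j $ l * \<rho> t $ l))) (at t within J)) \<longleftrightarrow>
      (\<forall>j. 0 < \<rho> t $ j \<and>
        ((\<lambda>s. \<rho> s $ j) has_real_derivative flux (\<rho> t) (S t) j) (at t within J) \<and>
        ((\<lambda>s. S s $ j) has_real_derivative - force V (\<rho> t) (S t) j) (at t within J))"
    \<comment> \<open>The partial derivative of the Fisher information is known only at positive
      densities. Without positivity both sides are false.\<close>
    proof (cases "\<forall>j. 0 < \<rho> t $ j")
      case True
      then have "0 < \<rho> t $ j" for j by simp
      from 2[OF this] show ?thesis by (simp only:)
    qed auto
  qed
qed

lemma sum_flux: "(\<Sum>j\<in>UNIV. flux \<rho> S j) = 0"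
proof -
  have "(\<Sum>j\<in>UNIV. flux \<rho> S j) = (\<Sum>l\<in>UNIV. \<Sum>j\<in>UNIV. weight j l * ((S $ j - S $ l) * ((\<rho> $ j + \<rho> $ l) / 2)))"
    unfolding flux_def by (rule sum.swap)
  also have "\<dots> = (\<Sum>l\<in>UNIV. - flux \<rho> S l)"
    unfolding flux_def sum_negf[symmetric]
    by (intro sum.cong refl) (simp add: weight_sym field_simps)
  finally show ?thesis by (simp add: sum_negf)
qed

lemma gnls_mass:
  assumes sol: "gnls_solution J h E \<omega> V W \<rho> S" and J: "convex J" "0 \<in> J" "t \<in> J"
  shows "(\<Sum>j\<in>UNIV. \<rho> t $ j) = (\<Sum>j\<in>UNIV. \<rho> 0 $ j)"
proof -
  have "((\<lambda>s. \<Sum>j\<in>UNIV. \<rho> s $ j) has_real_derivative 0) (at t within J)" if "t \<in> J" for t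
    unfolding sum_flux[of "\<rho> t" "S t", symmetric]
    by (intro DERIV_sum) (use sol that in \<open>auto simp: gnls_solution_iff\<close>)
  then obtain c where "\<forall>s\<in>J. (\<Sum>j\<in>UNIV. \<rho> s $ j) = c"
    using has_field_derivative_zero_constant[OF J(1), of "\<lambda>s. \<Sum>j\<in>UNIV. \<rho> s $ j"] by blast
  then show ?thesis using J by simp
qed

lemma gnls_energy:
  assumes sol: "gnls_solution J h E \<omega> V W \<rho> S" and J: "convex J" "0 \<in> J" "t \<in> J"
  shows "hamiltonian V (\<rho> t) (S t) = hamiltonian V (\<rho> 0) (S 0)"
proof -
  have "((\<lambda>s. hamiltonian V (\<rho> s) (S s)) has_real_derivative 0) (at t within J)" if "t \<in> J" for t
  proof -
    have "((\<lambda>s. hamiltonian V (\<rho> s) (S s)) has_real_derivative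
       (\<Sum>j\<in>UNIV. force V (\<rho> t) (S t) j * flux (\<rho> t) (S t) j + flux (\<rho> t) (S t) j * (- force V (\<rho> t) (S t) j))) (at t within J)"
      by (rule hamiltonian_has_derivative) (use sol that in \<open>auto simp: gnls_solution_iff\<close>)
    then show ?thesis by (simp add: mult.commute)
  qed
  then obtain c where "\<forall>s\<in>J. hamiltonian V (\<rho> s) (S s) = c"
    using has_field_derivative_zero_constant[OF J(1), of "\<lambda>s. hamiltonian V (\<rho> s) (S s)"] by blast
  then show ?thesis using J by simp
qed

text \<open>The logarithm of the wave carries ln \<rho> / 2, and the square of this 1/2 turns the
  real part into h^2 / 8 times the Fisher information. The phases enter as S / h, so the prefactor
  h^2 cancels and h disappears from their share.\<close>

lemma total_energy_eq_hamiltonian: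
  assumes "\<And>j. \<rho> $ j > 0"
  shows "total_energy h E \<omega> V W (log_wave h \<rho> S) (wave h \<rho> S) = hamiltonian V \<rho> S"
proof -
  have c: "(cmod (wave h \<rho> S $ j))\<^sup>2 = \<rho> $ j" for j
    using assms[of j] by (simp add: wave_def norm_mult less_imp_le)
  have e0: "h\<^sup>2 * (((ln (\<rho> $ j) / 2 - ln (\<rho> $ l) / 2)\<^sup>2 + (S $ j / h - S $ l / h)\<^sup>2) * ((\<rho> $ j + \<rho> $ l) / 2))
      = (h\<^sup>2 / 4) * ((ln (\<rho> $ j) - ln (\<rho> $ l))\<^sup>2 * ((\<rho> $ j + \<rho> $ l) / 2)) + ((S $ j - S $ l)\<^sup>2 * (\<rho> $ j + \<rho> $ l)) / 2" for j l
    using h_pos by (simp add: field_simps power2_eq_square)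
  have e: "weight j l * (h\<^sup>2 * (((ln (\<rho> $ j) / 2 - ln (\<rho> $ l) / 2)\<^sup>2 + (S $ j / h - S $ l / h)\<^sup>2) * ((\<rho> $ j + \<rho> $ l) / 2)))
      = (h\<^sup>2 / 4) * (weight j l * ((ln (\<rho> $ j) - ln (\<rho> $ l))\<^sup>2 * ((\<rho> $ j + \<rho> $ l) / 2)))
        + (weight j l * ((S $ j - S $ l)\<^sup>2 * (\<rho> $ j + \<rho> $ l))) / 2" for j l
    by (simp only: e0 distrib_left[of "weight j l"]) (simp add: mult.left_commute)
  have "h\<^sup>2 * kinetic_energy E \<omega> (log_wave h \<rho> S) (wave h \<rho> S)
      = (\<Sum>j\<in>UNIV. \<Sum>l\<in>UNIV. weight j l * (h\<^sup>2 * (((ln (\<rho> $ j) / 2 - ln (\<rho> $ l) / 2)\<^sup>2 + (S $ j / h - S $ l / h)\<^sup>2) * ((\<rho> $ j + \<rho> $ l) / 2)))) / 4"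
    unfolding kinetic_energy_def edge_mean_def density_def vec_lambda_beta c mult.assoc sum_edges
    by (simp add: log_wave_def sum_distrib_left mult_ac)
  also have "\<dots> = h\<^sup>2 / 8 * fisher_information E \<omega> \<rho> + (\<Sum>j\<in>UNIV. \<Sum>l\<in>UNIV. weight j l * ((S $ j - S $ l)\<^sup>2 * (\<rho> $ j + \<rho> $ l))) / 8"
    unfolding e sum.distrib sum_distrib_left[symmetric] sum_divide_distrib[symmetric] fisher_information_eq by simp
  finally show ?thesis
    unfolding total_energy_def hamiltonian_def potential_energy_def interaction_energy_def c
    by (simp add: mult.assoc)
qed

section \<open>A priori bounds and global solutions\<close>

text \<open>The system in the unknowns \<open>(ln \<rho>, S)\<close>, where positivity of \<open>\<rho>\<close> is no constraint and the
  right-hand side is Lipschitz on every ball.\<close>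

definition log_field :: "real ^ 'n \<Rightarrow> (real ^ 'n) \<times> (real ^ 'n) \<Rightarrow> (real ^ 'n) \<times> (real ^ 'n)" where
  "log_field V x =
     (\<chi> j. \<Sum>l\<in>UNIV. weight j l * ((snd x $ j - snd x $ l) * ((1 + exp (fst x $ l - fst x $ j)) / 2)),
      \<chi> j. - ((\<Sum>l\<in>UNIV. weight j l * (snd x $ j - snd x $ l)\<^sup>2) / 4
        + h\<^sup>2 / 8 * (\<Sum>l\<in>UNIV. weight j l *
            ((fst x $ j - fst x $ l) * (1 + exp (fst x $ l - fst x $ j)) + (fst x $ j - fst x $ l)\<^sup>2 / 2))
        + V $ j + (\<Sum>l\<in>UNIV. W $ j $ l * exp (fst x $ l))))"

lemma log_field_lipschitz: "\<exists>L. L-lipschitz_on (cball 0 R) (log_field V)"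
proof -
  have 1: "bounded_lipschitz (cball 0 R) (\<lambda>x :: (real ^ 'n) \<times> (real ^ 'n). fst x $ j)"
    and 2: "bounded_lipschitz (cball 0 R) (\<lambda>x :: (real ^ 'n) \<times> (real ^ 'n). snd x $ j)" for j
    by (rule bounded_lipschitz_linear;
        auto intro: bounded_linear_compose[OF bounded_linear_vec_nth] bounded_linear_fst bounded_linear_snd)+
  note intros = 1 2 bounded_lipschitz_const bounded_lipschitz_add bounded_lipschitz_diff bounded_lipschitz_mult
    bounded_lipschitz_divide bounded_lipschitz_power2 bounded_lipschitz_exp bounded_lipschitz_uminus
    bounded_lipschitz_sum[OF finite_class.finite_UNIV]
  show ?thesis unfolding log_field_def
    by (rule lipschitz_on_pair_of_vec) (intro intros)+
qed

text \<open>Since (ln \<rho>_j)' = \<rho>_j' / \<rho>_j, the field for ln \<rho> is the flux divided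
  by the density.\<close>

lemma flux_exp: "flux (\<chi> j. exp (u $ j)) S j = exp (u $ j) * fst (log_field V (u, S)) $ j"
proof -
  have "exp (u $ j) * (1 + exp (u $ l - u $ j)) = exp (u $ j) + exp (u $ l)" for l
    by (simp add: exp_diff field_simps)
  then have "exp (u $ j) * ((1 + exp (u $ l - u $ j)) / 2) = (exp (u $ j) + exp (u $ l)) / 2" for l
    by (simp add: field_simps)
  then show ?thesis unfolding flux_def log_field_def
    by (simp add: sum_distrib_left mult.left_commute[of "exp (u $ j)"])
qed

lemma force_exp: "force V (\<chi> j. exp (u $ j)) S j = - snd (log_field V (u, S)) $ j"
  unfolding force_def fisher_grad_def log_field_def by (simp add: exp_diff)

lemma gnls_imp_log_field_solution:
  assumes "gnls_solution J h E \<omega> V W \<rho> S"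
  shows "ode_solution J (log_field V) (\<lambda>t. (\<chi> j. ln (\<rho> t $ j), S t))"
  unfolding ode_solution_def
proof
  fix t assume t: "t \<in> J"
  define u where "u = (\<chi> j. ln (\<rho> t $ j))"
  have pos: "0 < \<rho> t $ j" for j using assms t by (simp add: gnls_solution_iff)
  then have \<rho>: "\<rho> t = (\<chi> j. exp (u $ j))" by (simp add: u_def vec_eq_iff)
  have "((\<lambda>s. \<chi> j. ln (\<rho> s $ j)) has_vector_derivative fst (log_field V (u, S t))) (at t within J)"
  proof (rule has_vector_derivative_vecI)
    fix j
    have "((\<lambda>s. \<rho> s $ j) has_real_derivative flux (\<rho> t) (S t) j) (at t within J)"
      using assms t by (simp add: gnls_solution_iff)
    from DERIV_chain2[OF DERIV_ln[OF pos] this]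
    show "((\<lambda>s. (\<chi> j. ln (\<rho> s $ j)) $ j) has_real_derivative fst (log_field V (u, S t)) $ j) (at t within J)"
      unfolding \<rho> flux_exp[where V=V] by (simp add: field_simps)
  qed
  moreover have "(S has_vector_derivative snd (log_field V (u, S t))) (at t within J)"
    by (rule has_vector_derivative_vecI)
      (use assms t force_exp[of V u "S t"] \<rho> in \<open>auto simp: gnls_solution_iff\<close>)
  ultimately show "((\<lambda>t. (\<chi> j. ln (\<rho> t $ j), S t)) has_vector_derivative
      log_field V (\<chi> j. ln (\<rho> t $ j), S t)) (at t within J)"
    using has_vector_derivative_Pair unfolding u_def by fastforce
qed

lemma log_field_solution_imp_gnls:
  assumes "ode_solution J (log_field V) x"
  shows "gnls_solution J h E \<omega> V W (\<lambda>t. \<chi> j. exp (fst (x t) $ j)) (\<lambda>t. snd (x t))"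
  unfolding gnls_solution_iff
proof (intro ballI allI conjI)
  fix t j assume t: "t \<in> J"
  have d: "(x has_vector_derivative log_field V (x t)) (at t within J)"
    using assms t by (simp add: ode_solution_def)
  have 1: "((\<lambda>s. fst (x s) $ j) has_real_derivative fst (log_field V (x t)) $ j) (at t within J)"
    by (intro has_real_derivative_vec_nth bounded_linear.has_vector_derivative[OF bounded_linear_fst] d)
  have 2: "((\<lambda>s. snd (x s) $ j) has_real_derivative snd (log_field V (x t)) $ j) (at t within J)"
    by (intro has_real_derivative_vec_nth bounded_linear.has_vector_derivative[OF bounded_linear_snd] d)
  show "((\<lambda>s. (\<chi> j. exp (fst (x s) $ j)) $ j) has_real_derivative
      flux (\<chi> j. exp (fst (x t) $ j)) (snd (x t)) j) (at t within J)"
    using DERIV_chain2[OF DERIV_exp 1] unfolding flux_exp[where V=V] by simp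
  show "((\<lambda>s. snd (x s) $ j) has_real_derivative
      - force V (\<chi> j. exp (fst (x t) $ j)) (snd (x t)) j) (at t within J)"
    using 2 unfolding force_exp by simp
qed simp

section \<open>Bounds from the conserved energy\<close>

text \<open>On the simplex all densities are at most 1, so the potential and interaction energies
  together are at least minus this number.\<close>

definition potential_bound :: "real ^ 'n \<Rightarrow> real" where
  "potential_bound V = (\<Sum>j\<in>UNIV. \<bar>V $ j\<bar>) + (\<Sum>j\<in>UNIV. \<Sum>l\<in>UNIV. \<bar>W $ j $ l\<bar>) / 2"

lemma open_prob_simplex_le_1:
  assumes "\<rho> \<in> open_prob_simplex"
  shows "\<rho> $ j \<le> 1"
  using assms member_le_sum[of j UNIV "\<lambda>j. \<rho> $ j"] by (auto simp: open_prob_simplex_def less_imp_le)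

text \<open>Both edge sums have nonnegative terms, so once the remaining energies are bounded below
  each single term is bounded. The constants invert the coefficients in the energy: 1/8 for the
  phases, h^2 / 8 * 1/4 for the logarithms.\<close>

lemma edge_terms_bound:
  assumes \<rho>: "\<rho> \<in> open_prob_simplex" and K: "hamiltonian V \<rho> S \<le> K"
  shows "weight j l * ((S $ j - S $ l)\<^sup>2 * (\<rho> $ j + \<rho> $ l)) \<le> 8 * (K + potential_bound V)"
    and "weight j l * ((ln (\<rho> $ j) - ln (\<rho> $ l))\<^sup>2 * (\<rho> $ j + \<rho> $ l)) \<le> 32 * (K + potential_bound V) / h\<^sup>2"
proof -
  define A where "A j l = weight j l * ((S $ j - S $ l)\<^sup>2 * (\<rho> $ j + \<rho> $ l))" for j l
  define B where "B j l = weight j l * ((ln (\<rho> $ j) - ln (\<rho> $ l))\<^sup>2 * (\<rho> $ j + \<rho> $ l))" for j l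
  have pos: "0 \<le> \<rho> $ j" "\<rho> $ j \<le> 1" for j
    using \<rho> open_prob_simplex_le_1[OF \<rho>] by (auto simp: open_prob_simplex_def less_imp_le)
  have AB: "0 \<le> A j l" "0 \<le> B j l" for j l
    unfolding A_def B_def using pos weight_nonneg by simp_all
  have sing: "X j l \<le> (\<Sum>j\<in>UNIV. \<Sum>l\<in>UNIV. X j l)" if "\<And>j l. 0 \<le> X j l" for X :: "'n \<Rightarrow> 'n \<Rightarrow> real"
  proof -
    have "X j l \<le> (\<Sum>l\<in>UNIV. X j l)" using that by (intro member_le_sum) auto
    also have "\<dots> \<le> (\<Sum>j\<in>UNIV. \<Sum>l\<in>UNIV. X j l)"
      using that by (intro member_le_sum[of j UNIV "\<lambda>j. \<Sum>l\<in>UNIV. X j l"]) (auto intro: sum_nonneg)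
    finally show ?thesis .
  qed
  have "- \<bar>V $ j\<bar> \<le> V $ j * \<rho> $ j" for j
    using pos[of j] mult_left_le[of "\<rho> $ j" "\<bar>V $ j\<bar>"] abs_mult[of "V $ j" "\<rho> $ j"] by linarith
  then have v: "- (\<Sum>j\<in>UNIV. \<bar>V $ j\<bar>) \<le> (\<Sum>j\<in>UNIV. V $ j * \<rho> $ j)"
    unfolding sum_negf[symmetric] by (intro sum_mono)
  have "- \<bar>W $ j $ l\<bar> \<le> W $ j $ l * (\<rho> $ j * \<rho> $ l)" for j l
    using pos[of j] pos[of l] mult_le_one[of "\<rho> $ j" "\<rho> $ l"] mult_left_le[of "\<rho> $ j * \<rho> $ l" "\<bar>W $ j $ l\<bar>"]
      abs_mult[of "W $ j $ l" "\<rho> $ j * \<rho> $ l"] abs_of_nonneg[of "\<rho> $ j * \<rho> $ l"] mult_nonneg_nonneg[of "\<rho> $ j" "\<rho> $ l"]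
    by linarith
  then have w: "- (\<Sum>j\<in>UNIV. \<Sum>l\<in>UNIV. \<bar>W $ j $ l\<bar>) \<le> (\<Sum>j\<in>UNIV. \<Sum>l\<in>UNIV. W $ j $ l * (\<rho> $ j * \<rho> $ l))"
    unfolding sum_negf[symmetric] by (intro sum_mono)
  have fi: "fisher_information E \<omega> \<rho> = (\<Sum>j\<in>UNIV. \<Sum>l\<in>UNIV. B j l) / 4"
    unfolding fisher_information_eq B_def by (simp add: sum_divide_distrib)
  have le: "(\<Sum>j\<in>UNIV. \<Sum>l\<in>UNIV. A j l) / 8 + h\<^sup>2 / 32 * (\<Sum>j\<in>UNIV. \<Sum>l\<in>UNIV. B j l) \<le> K + potential_bound V"
    using K v w unfolding hamiltonian_def fi potential_bound_def A_def by simp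
  have sA: "A j l \<le> (\<Sum>j\<in>UNIV. \<Sum>l\<in>UNIV. A j l)" by (rule sing[of A, OF AB(1)])
  have "0 \<le> h\<^sup>2 / 32 * (\<Sum>j\<in>UNIV. \<Sum>l\<in>UNIV. B j l)" using AB by (simp add: sum_nonneg)
  then have "(\<Sum>j\<in>UNIV. \<Sum>l\<in>UNIV. A j l) / 8
      \<le> (\<Sum>j\<in>UNIV. \<Sum>l\<in>UNIV. A j l) / 8 + h\<^sup>2 / 32 * (\<Sum>j\<in>UNIV. \<Sum>l\<in>UNIV. B j l)"
    by (simp only: le_add_same_cancel1)
  also note le
  finally have "A j l \<le> 8 * (K + potential_bound V)" using sA by simp
  then show "weight j l * ((S $ j - S $ l)\<^sup>2 * (\<rho> $ j + \<rho> $ l)) \<le> 8 * (K + potential_bound V)"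
    by (simp add: A_def)
  have "h\<^sup>2 / 32 * B j l \<le> h\<^sup>2 / 32 * (\<Sum>j\<in>UNIV. \<Sum>l\<in>UNIV. B j l)"
    using sing[of B, OF AB(2)] by (intro mult_left_mono) auto
  also have "\<dots> \<le> K + potential_bound V"
  proof (rule order_trans[OF _ le])
    have "0 \<le> (\<Sum>j\<in>UNIV. \<Sum>l\<in>UNIV. A j l) / 8" using AB by (simp add: sum_nonneg)
    then show "h\<^sup>2 / 32 * (\<Sum>j\<in>UNIV. \<Sum>l\<in>UNIV. B j l)
      \<le> (\<Sum>j\<in>UNIV. \<Sum>l\<in>UNIV. A j l) / 8 + h\<^sup>2 / 32 * (\<Sum>j\<in>UNIV. \<Sum>l\<in>UNIV. B j l)"
      by (simp only: le_add_same_cancel2)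
  qed
  finally show "weight j l * ((ln (\<rho> $ j) - ln (\<rho> $ l))\<^sup>2 * (\<rho> $ j + \<rho> $ l)) \<le> 32 * (K + potential_bound V) / h\<^sup>2"
    using h_pos unfolding B_def[symmetric] by (simp add: field_simps)
qed

text \<open>Some vertex carries mass at least \<open>1 / CARD('n)\<close>, and the Fisher information controls the
  ratio of the masses at the two ends of an edge once one of them is bounded below.\<close>

lemma density_lower_bound:
  "\<exists>c>0. \<forall>\<rho> S j. \<rho> \<in> open_prob_simplex \<and> hamiltonian V \<rho> S \<le> K \<longrightarrow> c \<le> \<rho> $ j"
proof -
  have "\<exists>c>0. \<forall>\<rho> S. \<rho> \<in> open_prob_simplex \<and> hamiltonian V \<rho> S \<le> K \<and> 1 / CARD('n) \<le> \<rho> $ k \<longrightarrow> c \<le> \<rho> $ j" for k j :: 'n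
  proof -
    have "(k, j) \<in> E\<^sup>*" using graph by (simp add: connected_weighted_graph_def)
    then show ?thesis
    proof (induction rule: rtrancl_induct)
      case base
      show ?case by (rule exI[of _ "1 / CARD('n)"]) simp
    next
      case (step a b)
      then obtain c where c: "c > 0" and ca: "\<And>\<rho> S. \<rho> \<in> open_prob_simplex \<Longrightarrow> hamiltonian V \<rho> S \<le> K \<Longrightarrow>
          1 / CARD('n) \<le> \<rho> $ k \<Longrightarrow> c \<le> \<rho> $ a" by blast
      have w: "weight a b > 0" by (rule weight_pos[OF step(2)])
      define N where "N = 32 * (K + potential_bound V) / h\<^sup>2"
      \<comment> \<open>Since \<rho>_a + \<rho>_b is at least \<open>c\<close>, the squared
        log-ratio across the edge is at most \<open>M\<close>. Hence one step along a path costs at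
        most the factor exp (- sqrt M).\<close>
      define M where "M = N / (weight a b * c)"
      show ?case
      proof (intro exI[of _ "c * exp (- sqrt M)"] conjI allI impI)
        fix \<rho> S assume *: "\<rho> \<in> open_prob_simplex \<and> hamiltonian V \<rho> S \<le> K \<and> 1 / CARD('n) \<le> \<rho> $ k"
        then have pos: "\<rho> $ j > 0" for j by (simp add: open_prob_simplex_def)
        have ra: "c \<le> \<rho> $ a" using ca * by blast
        let ?d = "ln (\<rho> $ a) - ln (\<rho> $ b)"
        have "weight a b * (?d\<^sup>2 * c) \<le> weight a b * (?d\<^sup>2 * (\<rho> $ a + \<rho> $ b))"
          using ra pos[of b] w by (intro mult_left_mono) auto
        also have "\<dots> \<le> N" using edge_terms_bound(2) * unfolding N_def by blast
        finally have "?d\<^sup>2 \<le> M" using w c unfolding M_def by (simp add: pos_le_divide_eq mult_ac)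
        then have "\<bar>?d\<bar> \<le> sqrt M" using real_le_rsqrt[of "\<bar>?d\<bar>" M] by simp
        then have "ln c - sqrt M \<le> ln (\<rho> $ b)"
          using ln_mono[OF ra c] ra c by linarith
        then have "exp (ln c - sqrt M) \<le> \<rho> $ b" using pos[of b] ln_ge_iff by blast
        then show "c * exp (- sqrt M) \<le> \<rho> $ b" using c by (simp add: exp_diff exp_minus field_simps)
      qed (use c in simp)
    qed
  qed
  then obtain c where c: "\<And>k j. c k j > 0" and lb: "\<And>k j \<rho> S. \<rho> \<in> open_prob_simplex \<Longrightarrow> hamiltonian V \<rho> S \<le> K \<Longrightarrow>
          1 / CARD('n) \<le> \<rho> $ k \<Longrightarrow> c k j \<le> \<rho> $ j" by metis
  \<comment> \<open>The vertex that carries much mass varies with \<rho>; the minimum over the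
    finitely many pairs removes this dependence.\<close>
  define m where "m = Min (range (\<lambda>(k, j). c k j))"
  have m: "m > 0" unfolding m_def using c by (subst Min_gr_iff) auto
  have mc: "m \<le> c k j" for k j unfolding m_def by (rule Min_le) (auto intro!: image_eqI[of _ _ "(k, j)"])
  show ?thesis
  proof (intro exI[of _ m] conjI allI impI m)
    fix \<rho> S j assume *: "\<rho> \<in> open_prob_simplex \<and> hamiltonian V \<rho> S \<le> K"
    have "\<exists>k. 1 / CARD('n) \<le> \<rho> $ k"
    proof (rule ccontr)
      assume "\<nexists>k. 1 / CARD('n) \<le> \<rho> $ k"
      then have "(\<Sum>k\<in>UNIV. \<rho> $ k) < (\<Sum>k\<in>(UNIV :: 'n set). 1 / CARD('n))"
        by (intro sum_strict_mono) (auto simp: not_le)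
      then show False using * by (simp add: open_prob_simplex_def)
    qed
    then show "m \<le> \<rho> $ j" using lb * mc order_trans by metis
  qed
qed

text \<open>Mass and energy confine ln \<rho> and the phase differences on a fixed range, but each
  single phase may drift. It is bounded by its initial value plus its maximal speed times
  \<open>T\<close>.\<close>

lemma log_field_apriori_bound:
  assumes \<rho>0: "\<rho>0 \<in> open_prob_simplex" and T: "T \<ge> 0"
  shows "\<exists>R. \<forall>\<tau> x. 0 \<le> \<tau> \<and> \<tau> \<le> T \<and> x 0 = (\<chi> j. ln (\<rho>0 $ j), S0) \<and>
    ode_solution {0..\<tau>} (log_field V) x \<longrightarrow> norm (x \<tau>) \<le> R"
proof -
  define K where "K = hamiltonian V \<rho>0 S0"
  obtain c where c: "c > 0" and lb: "\<And>\<rho> S j. \<rho> \<in> open_prob_simplex \<Longrightarrow> hamiltonian V \<rho> S \<le> K \<Longrightarrow> c \<le> \<rho> $ j"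
    using density_lower_bound[of V K] by blast
  \<comment> \<open>\<open>U\<close> bounds ln \<rho> because \<rho> lies between \<open>c\<close>
    and 1. \<open>Q\<close> bounds a weighted squared phase difference, the densities at two
    vertices adding up to at least \<open>2 * c\<close>. \<open>C j\<close> is the resulting bound
    on the speed of S_j.\<close>
  define U where "U = \<bar>ln c\<bar>"
  define Q where "Q = 8 * (K + potential_bound V) / (2 * c)"
  define C where "C j = (\<Sum>l\<in>(UNIV::'n set). Q) / 4
      + h\<^sup>2 / 8 * (\<Sum>l\<in>UNIV. weight j l * (2 * U * (1 + exp (2 * U)) + (2 * U)\<^sup>2 / 2))
      + \<bar>V $ j\<bar> + (\<Sum>l\<in>UNIV. \<bar>W $ j $ l\<bar>)" for j
  show ?thesis
  proof (intro exI[of _ "(\<Sum>j\<in>(UNIV::'n set). U) + (\<Sum>j\<in>UNIV. \<bar>S0 $ j\<bar> + \<bar>C j\<bar> * T)"] allI impI)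
    fix \<tau> x assume *: "0 \<le> \<tau> \<and> \<tau> \<le> T \<and> x 0 = (\<chi> j. ln (\<rho>0 $ j), S0) \<and> ode_solution {0..\<tau>} (log_field V) x"
    define \<rho> where "\<rho> t = (\<chi> j. exp (fst (x t) $ j))" for t
    define S where "S t = snd (x t)" for t
    have sol: "gnls_solution {0..\<tau>} h E \<omega> V W \<rho> S"
      using log_field_solution_imp_gnls * unfolding \<rho>_def[abs_def] S_def[abs_def] by blast
    have init: "\<rho> 0 = \<rho>0" "S 0 = S0"
      using * \<rho>0 by (auto simp: \<rho>_def S_def vec_eq_iff open_prob_simplex_def)
    have simplex: "\<rho> t \<in> open_prob_simplex" if "t \<in> {0..\<tau>}" for t
      using gnls_mass[OF sol, of t] that \<rho>0 init by (simp add: open_prob_simplex_def) (simp add: \<rho>_def)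
    have energy: "hamiltonian V (\<rho> t) (S t) \<le> K" if "t \<in> {0..\<tau>}" for t
      using gnls_energy[OF sol, of t] that init by (simp add: K_def)
    have u: "\<bar>fst (x t) $ j\<bar> \<le> U" and u0: "exp (fst (x t) $ j) \<le> 1" if "t \<in> {0..\<tau>}" for t j
    proof -
      have "c \<le> exp (fst (x t) $ j)" "exp (fst (x t) $ j) \<le> 1"
        using lb[OF simplex[OF that] energy[OF that], of j] open_prob_simplex_le_1[OF simplex[OF that], of j]
        by (auto simp: \<rho>_def)
      then show "exp (fst (x t) $ j) \<le> 1" "\<bar>fst (x t) $ j\<bar> \<le> U"
        unfolding U_def using ln_le_cancel_iff[of c "exp (fst (x t) $ j)"] c by auto
    qed
    have wS: "weight j l * (S t $ j - S t $ l)\<^sup>2 \<le> Q" if "t \<in> {0..\<tau>}" for t j l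
    proof -
      have "weight j l * (S t $ j - S t $ l)\<^sup>2 * (2 * c) \<le> weight j l * (S t $ j - S t $ l)\<^sup>2 * (\<rho> t $ j + \<rho> t $ l)"
        using lb[OF simplex[OF that] energy[OF that], of j] lb[OF simplex[OF that] energy[OF that], of l] weight_nonneg[of j l]
        by (intro mult_left_mono) auto
      also have "\<dots> \<le> 8 * (K + potential_bound V)"
        using edge_terms_bound(1)[OF simplex[OF that] energy[OF that], of j l] by (simp add: mult.assoc)
      finally show ?thesis unfolding Q_def using c by (simp add: pos_le_divide_eq)
    qed
    have rate: "\<bar>snd (log_field V (x t)) $ j\<bar> \<le> C j" if t: "t \<in> {0..\<tau>}" for t j
    proof -
      have f: "\<bar>(\<Sum>l\<in>UNIV. weight j l * ((fst (x t) $ j - fst (x t) $ l) * (1 + exp (fst (x t) $ l - fst (x t) $ j))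
             + (fst (x t) $ j - fst (x t) $ l)\<^sup>2 / 2))\<bar>
          \<le> (\<Sum>l\<in>UNIV. weight j l * (2 * U * (1 + exp (2 * U)) + (2 * U)\<^sup>2 / 2))"
      proof (rule order_trans[OF sum_abs sum_mono])
        fix l
        define d where "d = fst (x t) $ j - fst (x t) $ l"
        have d: "\<bar>d\<bar> \<le> 2 * U" "exp (- d) \<le> exp (2 * U)" using u[OF t, of j] u[OF t, of l] unfolding d_def by auto
        have "\<bar>d * (1 + exp (- d)) + d\<^sup>2 / 2\<bar> \<le> \<bar>d\<bar> * (1 + exp (- d)) + d\<^sup>2 / 2"
          using abs_triangle_ineq[of "d * (1 + exp (- d))" "d\<^sup>2 / 2"] by (simp add: abs_mult)
        also have "\<dots> \<le> 2 * U * (1 + exp (2 * U)) + (2 * U)\<^sup>2 / 2"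
          using d power_mono[OF d(1), of 2] by (intro add_mono mult_mono divide_right_mono) auto
        finally show "\<bar>weight j l * ((fst (x t) $ j - fst (x t) $ l) * (1 + exp (fst (x t) $ l - fst (x t) $ j))
             + (fst (x t) $ j - fst (x t) $ l)\<^sup>2 / 2)\<bar> \<le> weight j l * (2 * U * (1 + exp (2 * U)) + (2 * U)\<^sup>2 / 2)"
          unfolding d_def abs_mult using weight_nonneg[of j l] by (auto intro!: mult_left_mono)
      qed
      have s: "\<bar>\<Sum>l\<in>UNIV. weight j l * (S t $ j - S t $ l)\<^sup>2\<bar> \<le> (\<Sum>l\<in>(UNIV::'n set). Q)"
        by (rule order_trans[OF sum_abs sum_mono]) (use wS[OF t] weight_nonneg in \<open>simp add: abs_mult\<close>)
      have w: "\<bar>\<Sum>l\<in>UNIV. W $ j $ l * exp (fst (x t) $ l)\<bar> \<le> (\<Sum>l\<in>UNIV. \<bar>W $ j $ l\<bar>)"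
        by (rule order_trans[OF sum_abs sum_mono]) (use u0[OF t] in \<open>simp add: abs_mult mult_left_le\<close>)
      have f': "\<bar>h\<^sup>2 / 8 * (\<Sum>l\<in>UNIV. weight j l * ((fst (x t) $ j - fst (x t) $ l) * (1 + exp (fst (x t) $ l - fst (x t) $ j))
             + (fst (x t) $ j - fst (x t) $ l)\<^sup>2 / 2))\<bar>
          \<le> h\<^sup>2 / 8 * (\<Sum>l\<in>UNIV. weight j l * (2 * U * (1 + exp (2 * U)) + (2 * U)\<^sup>2 / 2))"
        unfolding abs_mult using f by (simp add: mult_left_mono)
      show ?thesis using s f' w unfolding C_def log_field_def S_def snd_conv vec_lambda_beta abs_minus_cancel by linarith
    qed
    have Sb: "\<bar>S \<tau> $ j\<bar> \<le> \<bar>S0 $ j\<bar> + \<bar>C j\<bar> * T" for j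
    proof -
      have d: "((\<lambda>s. S s $ j) has_derivative (\<lambda>r. snd (log_field V (x t)) $ j * r)) (at t within {0..\<tau>})" if "t \<in> {0..\<tau>}" for t
        using * that unfolding S_def has_field_derivative_def[symmetric]
        by (intro has_real_derivative_vec_nth bounded_linear.has_vector_derivative[OF bounded_linear_snd])
          (auto simp: ode_solution_def)
      \<comment> \<open>This form of the mean value theorem admits \<tau> = 0.\<close>
      have "\<exists>t\<in>{0..\<tau>}. S \<tau> $ j - S 0 $ j = snd (log_field V (x t)) $ j * (\<tau> - 0)"
        using * d by (intro mvt_very_simple) auto
      then obtain t where t: "t \<in> {0..\<tau>}" and eq: "S \<tau> $ j - S 0 $ j = snd (log_field V (x t)) $ j * \<tau>" by auto
      have "\<bar>S \<tau> $ j - S 0 $ j\<bar> \<le> \<bar>C j\<bar> * T"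
        unfolding eq abs_mult using rate[OF t, of j] * by (intro mult_mono) auto
      then show ?thesis using init by simp
    qed
    have "norm (x \<tau>) \<le> norm (fst (x \<tau>)) + norm (snd (x \<tau>))"
      by (metis norm_Pair_le prod.collapse)
    also have "norm (fst (x \<tau>)) \<le> (\<Sum>j\<in>UNIV. \<bar>fst (x \<tau>) $ j\<bar>)" by (rule norm_le_l1_cart)
    also have "\<dots> \<le> (\<Sum>j\<in>(UNIV::'n set). U)" using * u[of \<tau>] by (intro sum_mono) auto
    also have "norm (snd (x \<tau>)) \<le> (\<Sum>j\<in>UNIV. \<bar>snd (x \<tau>) $ j\<bar>)" by (rule norm_le_l1_cart)
    also have "\<dots> \<le> (\<Sum>j\<in>UNIV. \<bar>S0 $ j\<bar> + \<bar>C j\<bar> * T)" using Sb unfolding S_def by (intro sum_mono) auto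
    finally show "norm (x \<tau>) \<le> (\<Sum>j\<in>(UNIV::'n set). U) + (\<Sum>j\<in>UNIV. \<bar>S0 $ j\<bar> + \<bar>C j\<bar> * T)" by simp
  qed
qed

section \<open>Global existence and uniqueness\<close>

lemma gnls_solution_unique:
  assumes sol: "gnls_solution {0..} h E \<omega> V W \<rho> S" "gnls_solution {0..} h E \<omega> V W \<rho>' S'"
    and init: "\<rho>' 0 = \<rho> 0" "S' 0 = S 0" and t: "t \<ge> 0"
  shows "\<rho>' t = \<rho> t \<and> S' t = S t"
proof -
  have "ode_solution {0..t} (log_field V) (\<lambda>t. (\<chi> j. ln (\<rho> t $ j), S t))"
    and "ode_solution {0..t} (log_field V) (\<lambda>t. (\<chi> j. ln (\<rho>' t $ j), S' t))"
    using sol by (auto intro: ode_solution_subset[of "{0..}"] gnls_imp_log_field_solution)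
  from ode_unique[OF log_field_lipschitz this, of t]
  have eq: "\<And>j. ln (\<rho> t $ j) = ln (\<rho>' t $ j)" "S' t = S t"
    using init t by (auto simp: vec_eq_iff)
  have "\<rho> t $ j > 0" "\<rho>' t $ j > 0" for j using sol t by (simp_all add: gnls_solution_iff)
  then have "\<rho>' t $ j = \<rho> t $ j" for j using eq(1)[of j] by simp
  then show ?thesis using eq(2) by (simp add: vec_eq_iff)
qed

lemma gnls_solution_exists:
  assumes \<rho>0: "\<rho>0 \<in> open_prob_simplex"
  shows "\<exists>\<rho> S. unique_gnls_solution {0..} h E \<omega> V W \<rho>0 S0 \<rho> S"
proof -
  have "\<exists>R. \<forall>\<tau> x. 0 \<le> \<tau> \<and> \<tau> \<le> T \<and> x 0 = (\<chi> j. ln (\<rho>0 $ j), S0) \<and>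
      ode_solution {0..\<tau>} (log_field V) x \<longrightarrow> norm (x \<tau>) \<le> R" for T
  proof (cases "T \<ge> 0")
    case True
    then show ?thesis by (rule log_field_apriori_bound[OF \<rho>0])
  qed auto
  from ode_global_exists[OF log_field_lipschitz this]
  obtain x where x0: "x 0 = (\<chi> j. ln (\<rho>0 $ j), S0)" and x: "ode_solution {0..} (log_field V) x" by blast
  define \<rho> where "\<rho> t = (\<chi> j. exp (fst (x t) $ j))" for t
  have \<rho>_init: "\<rho> 0 = \<rho>0" using x0 \<rho>0 by (auto simp: \<rho>_def vec_eq_iff open_prob_simplex_def)
  have sol: "gnls_solution {0..} h E \<omega> V W \<rho> (\<lambda>t. snd (x t))"
    unfolding \<rho>_def by (rule log_field_solution_imp_gnls[OF x])
  have "unique_gnls_solution {0..} h E \<omega> V W \<rho>0 S0 \<rho> (\<lambda>t. snd (x t))"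
    unfolding unique_gnls_solution_def using x0 \<rho>_init sol
    by (auto dest: gnls_solution_unique[OF sol])
  then show ?thesis by blast
qed

section \<open>Time reversal and gauge invariance\<close>

text \<open>The flux is odd and the force even in S, so the signs from reversing time are absorbed
  by S to - S, which conjugates the wave.\<close>

lemma gnls_solution_reverse:
  assumes "gnls_solution J h E \<omega> V W \<rho> S"
  shows "gnls_solution (uminus ` J) h E \<omega> V W (\<lambda>t. \<rho> (- t)) (\<lambda>t. - S (- t))"
  unfolding gnls_solution_iff
proof (intro ballI allI conjI)
  fix t j assume "t \<in> uminus ` J"
  then have t: "- t \<in> J" by auto
  have rev: "((\<lambda>s. f (- s)) has_real_derivative - D) (at t within uminus ` J)"
    if "(f has_real_derivative D) (at (- t) within J)" for f D
  proof -
    have "(f has_real_derivative D) (at (- t) within uminus ` uminus ` J)" using that by (simp add: image_image)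
    from DERIV_image_chain[OF this DERIV_minus[OF DERIV_ident]] show ?thesis
      by (simp add: o_def)
  qed
  have flux: "flux (\<rho> (- t)) (- S (- t)) j = - flux (\<rho> (- t)) (S (- t)) j"
    unfolding flux_def sum_negf[symmetric] by (intro sum.cong refl) (simp add: field_simps)
  have force: "force V (\<rho> (- t)) (- S (- t)) j = force V (\<rho> (- t)) (S (- t)) j"
    unfolding force_def by (simp add: power2_commute)
  show "((\<lambda>s. \<rho> (- s) $ j) has_real_derivative flux (\<rho> (- t)) (- S (- t)) j) (at t within uminus ` J)"
    unfolding flux using rev[of "\<lambda>s. \<rho> s $ j"] assms t by (simp add: gnls_solution_iff)
  show "((\<lambda>s. (- S (- s)) $ j) has_real_derivative - force V (\<rho> (- t)) (- S (- t)) j) (at t within uminus ` J)"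
    using DERIV_minus[OF rev[of "\<lambda>s. S s $ j"]] assms t by (simp add: gnls_solution_iff force)
  show "0 < \<rho> (- t) $ j" using assms t by (simp add: gnls_solution_iff)
qed

lemma unique_gnls_solution_reverse:
  assumes u: "unique_gnls_solution J h E \<omega> V W \<rho>0 S0 \<rho> S"
  shows "unique_gnls_solution (uminus ` J) h E \<omega> V W \<rho>0 (- S0) (\<lambda>t. \<rho> (- t)) (\<lambda>t. - S (- t))"
proof (rule unique_gnls_solutionI)
  show "gnls_solution (uminus ` J) h E \<omega> V W (\<lambda>t. \<rho> (- t)) (\<lambda>t. - S (- t))"
    by (rule gnls_solution_reverse[OF unique_gnls_solutionD(1)[OF u]])
  fix \<rho>' S' t
  assume sol: "gnls_solution (uminus ` J) h E \<omega> V W \<rho>' S'" and init: "\<rho>' 0 = \<rho>0" "S' 0 = - S0"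
    and t: "t \<in> uminus ` J"
  have "gnls_solution J h E \<omega> V W (\<lambda>t. \<rho>' (- t)) (\<lambda>t. - S' (- t))"
    using gnls_solution_reverse[OF sol] by (simp add: image_image)
  from unique_gnls_solutionD(4)[OF u this, of "- t"]
  have "\<rho>' t = \<rho> (- t)" "- S' t = S (- t)" using init t by auto
  then show "\<rho>' t = \<rho> (- t) \<and> S' t = - S (- t)" by (metis minus_minus)
qed (use unique_gnls_solutionD(2,3)[OF u] in simp_all)

text \<open>A common shift leaves all phase differences alone, hence also the flux and the kinetic
  part of the force; only S' registers the additional \<alpha>.\<close>

lemma gnls_solution_gauge:
  assumes "gnls_solution J h E \<omega> V W \<rho> S"
  shows "gnls_solution J h E \<omega> (\<chi> j. V $ j + \<alpha>) W \<rho> (\<lambda>t. \<chi> j. S t $ j - \<alpha> * t)"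
  unfolding gnls_solution_iff
proof (intro ballI allI conjI)
  fix t j assume t: "t \<in> J"
  have flux: "flux (\<rho> t) (\<chi> j. S t $ j - \<alpha> * t) j = flux (\<rho> t) (S t) j"
    unfolding flux_def by simp
  have force: "force (\<chi> j. V $ j + \<alpha>) (\<rho> t) (\<chi> j. S t $ j - \<alpha> * t) j = force V (\<rho> t) (S t) j + \<alpha>"
    unfolding force_def by simp
  show "((\<lambda>s. \<rho> s $ j) has_real_derivative flux (\<rho> t) (\<chi> j. S t $ j - \<alpha> * t) j) (at t within J)"
    unfolding flux using assms t by (simp add: gnls_solution_iff)
  have "((\<lambda>s. S s $ j) has_real_derivative - force V (\<rho> t) (S t) j) (at t within J)"
    using assms t by (simp add: gnls_solution_iff)
  then show "((\<lambda>s. (\<chi> j. S s $ j - \<alpha> * s) $ j) has_real_derivative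
      - force (\<chi> j. V $ j + \<alpha>) (\<rho> t) (\<chi> j. S t $ j - \<alpha> * t) j) (at t within J)"
    unfolding force by (auto intro!: derivative_eq_intros)
  show "0 < \<rho> t $ j" using assms t by (simp add: gnls_solution_iff)
qed

lemma unique_gnls_solution_gauge:
  assumes u: "unique_gnls_solution J h E \<omega> V W \<rho>0 S0 \<rho> S"
  shows "unique_gnls_solution J h E \<omega> (\<chi> j. V $ j + \<alpha>) W \<rho>0 S0 \<rho> (\<lambda>t. \<chi> j. S t $ j - \<alpha> * t)"
proof (rule unique_gnls_solutionI)
  show "gnls_solution J h E \<omega> (\<chi> j. V $ j + \<alpha>) W \<rho> (\<lambda>t. \<chi> j. S t $ j - \<alpha> * t)"
    by (rule gnls_solution_gauge[OF unique_gnls_solutionD(1)[OF u]])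
  fix \<rho>' S' t
  assume sol: "gnls_solution J h E \<omega> (\<chi> j. V $ j + \<alpha>) W \<rho>' S'" and init: "\<rho>' 0 = \<rho>0" "S' 0 = S0"
    and t: "t \<in> J"
  \<comment> \<open>The gauge transformation is inverted by - \<alpha>, so any competitor can be
    pulled back to the original potential.\<close>
  have "gnls_solution J h E \<omega> V W \<rho>' (\<lambda>t. \<chi> j. S' t $ j - (- \<alpha>) * t)"
    using gnls_solution_gauge[OF sol, of "- \<alpha>"] by simp
  from unique_gnls_solutionD(4)[OF u this init(1) _ t]
  have "\<rho>' t = \<rho> t" "(\<chi> j. S' t $ j - (- \<alpha>) * t) = S t" using init by simp_all
  then show "\<rho>' t = \<rho> t \<and> S' t = (\<chi> j. S t $ j - \<alpha> * t)" by (simp add: vec_eq_iff eq_diff_eq)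
qed (use unique_gnls_solutionD(2,3)[OF u] in simp_all)

section \<open>Standing waves and critical points\<close>

lemma sqrt_energy_eq_hamiltonian:
  assumes "\<And>j. \<rho> $ j > 0"
  shows "sqrt_energy h E \<omega> V W \<rho> = hamiltonian V \<rho> 0"
proof -
  have ln_sqrt_\<rho>: "ln (sqrt (\<rho> $ j)) = ln (\<rho> $ j) / 2" for j using ln_sqrt[of "\<rho> $ j"] assms[of j] by simp
  have "log_wave h \<rho> 0 = (\<chi> j. of_real (ln (sqrt (\<rho> $ j))))"
    by (simp add: log_wave_def vec_eq_iff ln_sqrt_\<rho>)
  moreover have "wave h \<rho> 0 = sqrt_state \<rho>" by (simp add: wave_def sqrt_state_def)
  ultimately show ?thesis
    using total_energy_eq_hamiltonian[OF assms, of V 0] by (simp add: sqrt_energy_def)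
qed

lemma sqrt_energy_partial_derivative:
  assumes pos: "\<And>j. \<rho> $ j > 0"
  shows "((\<lambda>s. sqrt_energy h E \<omega> V W (\<rho> + s *\<^sub>R axis j 1)) has_real_derivative force V \<rho> 0 j) (at 0)"
proof -
  have "((\<lambda>s. hamiltonian V (\<rho> + s *\<^sub>R axis j 1) 0) has_real_derivative
      (\<Sum>k\<in>UNIV. force V (\<rho> + 0 *\<^sub>R axis j 1) 0 k * axis j 1 $ k + flux (\<rho> + 0 *\<^sub>R axis j 1) 0 k * 0)) (at 0)"
    by (rule hamiltonian_has_derivative) (use pos in \<open>auto intro!: derivative_eq_intros\<close>)
  also have "(\<Sum>k\<in>UNIV. force V (\<rho> + 0 *\<^sub>R axis j 1) 0 k * axis j 1 $ k + flux (\<rho> + 0 *\<^sub>R axis j 1) 0 k * 0)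
      = (\<Sum>k\<in>UNIV. if k = j then force V \<rho> 0 k else 0)"
    by (intro sum.cong) (auto simp: axis_def)
  also have "\<dots> = force V \<rho> 0 j" by simp
  finally have d: "((\<lambda>s. hamiltonian V (\<rho> + s *\<^sub>R axis j 1) 0) has_real_derivative force V \<rho> 0 j) (at 0)" .
  \<comment> \<open>The moved point leaves the simplex, but for small s its coordinates stay
    positive, and the identity of the two energies asks for no more.\<close>
  have "sqrt_energy h E \<omega> V W (\<rho> + s *\<^sub>R axis j 1) = hamiltonian V (\<rho> + s *\<^sub>R axis j 1) 0"
    if "s \<in> {- (\<rho> $ j)<..<\<rho> $ j}" for s
    by (rule sqrt_energy_eq_hamiltonian) (use pos that in \<open>auto simp: axis_def\<close>)
  then show ?thesis
    using has_field_derivative_transform_within_open[OF d, of "{- (\<rho> $ j)<..<\<rho> $ j}"] pos[of j] by auto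
qed

text \<open>Euler's identity: the Fisher information is homogeneous of degree one.\<close>

lemma fisher_information_euler:
  assumes "\<And>j. \<rho> $ j > 0"
  shows "(\<Sum>j\<in>UNIV. fisher_grad \<rho> j * \<rho> $ j) = fisher_information E \<omega> \<rho>"
proof -
  define A where "A j l = (ln (\<rho> $ j) - ln (\<rho> $ l)) * (1 + \<rho> $ l / \<rho> $ j) + (ln (\<rho> $ j) - ln (\<rho> $ l))\<^sup>2 / 2" for j l
  have e: "A j l * \<rho> $ j + A l j * \<rho> $ l = (ln (\<rho> $ j) - ln (\<rho> $ l))\<^sup>2 * ((\<rho> $ j + \<rho> $ l) / 2)" for j l
    unfolding A_def using assms[of j] assms[of l] by (simp add: field_simps power2_eq_square)
  show ?thesis
    using sum_weight_symmetrize[of A "\<lambda>j. \<rho> $ j", unfolded e]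
    unfolding fisher_information_eq fisher_grad_def A_def[symmetric] by simp
qed

text \<open>The Fisher and potential terms have degree one. The interaction energy has degree two
  and is counted twice, which leaves one extra copy.\<close>

lemma force_euler:
  assumes "\<And>j. \<rho> $ j > 0"
  shows "(\<Sum>j\<in>UNIV. force V \<rho> 0 j * \<rho> $ j) = hamiltonian V \<rho> 0 + interaction_energy W (sqrt_state \<rho>)"
proof -
  have "(\<Sum>j\<in>UNIV. force V \<rho> 0 j * \<rho> $ j) = h\<^sup>2 / 8 * (\<Sum>j\<in>UNIV. fisher_grad \<rho> j * \<rho> $ j)
      + (\<Sum>j\<in>UNIV. V $ j * \<rho> $ j) + (\<Sum>j\<in>UNIV. \<Sum>l\<in>UNIV. W $ j $ l * (\<rho> $ j * \<rho> $ l))"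
  proof -
    have f: "force V \<rho> 0 j * \<rho> $ j = h\<^sup>2 / 8 * (fisher_grad \<rho> j * \<rho> $ j) + V $ j * \<rho> $ j
        + (\<Sum>l\<in>UNIV. W $ j $ l * (\<rho> $ j * \<rho> $ l))" for j
      by (simp add: force_def algebra_simps sum_distrib_left sum_distrib_right)
    show ?thesis unfolding f sum.distrib sum_distrib_left[of "h\<^sup>2 / 8"] ..
  qed
  moreover have "interaction_energy W (sqrt_state \<rho>) = (\<Sum>j\<in>UNIV. \<Sum>l\<in>UNIV. W $ j $ l * (\<rho> $ j * \<rho> $ l)) / 2"
    using assms by (simp add: interaction_energy_def sqrt_state_def less_imp_le mult.assoc)
  ultimately show ?thesis by (simp add: hamiltonian_def fisher_information_euler[OF assms])
qed

text \<open>Testing the vanishing flux against S and summing by parts gives a vanishing sum of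
  nonnegative terms, namely squared phase differences with positive edge means. So S is constant
  along each edge, and its share of the force disappears.\<close>

lemma force_eq_if_flux_zero:
  assumes pos: "\<And>j. \<rho> $ j > 0" and flux: "\<And>j. flux \<rho> S j = 0"
  shows "force V \<rho> S j = force V \<rho> 0 j"
proof -
  define A where "A j l = (S $ j - S $ l) * ((\<rho> $ j + \<rho> $ l) / 2)" for j l
  have e: "A j l * S $ j + A l j * S $ l = (S $ j - S $ l)\<^sup>2 * ((\<rho> $ j + \<rho> $ l) / 2)" for j l
    unfolding A_def by (simp add: field_simps power2_eq_square)
  have "(\<Sum>j\<in>UNIV. \<Sum>l\<in>UNIV. weight j l * ((S $ j - S $ l)\<^sup>2 * ((\<rho> $ j + \<rho> $ l) / 2))) = 0"
    using sum_weight_symmetrize[of A "\<lambda>j. S $ j", unfolded e] flux unfolding flux_def A_def[symmetric] by simp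
  moreover have nn: "0 \<le> weight j l * ((S $ j - S $ l)\<^sup>2 * ((\<rho> $ j + \<rho> $ l) / 2))" for j l
    using weight_nonneg pos by (simp add: less_imp_le add_nonneg_nonneg)
  ultimately have "weight j l * ((S $ j - S $ l)\<^sup>2 * ((\<rho> $ j + \<rho> $ l) / 2)) = 0" for j l
    by (simp add: sum_nonneg_eq_0_iff sum_nonneg)
  then have kin: "weight j l * (S $ j - S $ l)\<^sup>2 = 0" for j l
    using pos[of j] pos[of l] by (metis add_pos_pos half_gt_zero less_irrefl mult_eq_0_iff)
  then show ?thesis unfolding force_def kin by simp
qed

text \<open>Mass being stationary, the continuity equation kills all phase differences along edges, so
  that every component of the phase equation equates \<open>h * \<nu>\<close> with a partial derivative of the energy.
  The phase is compared with \<open>- \<nu> * t\<close> through its cosine and sine, which avoids choosing branches.\<close>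

lemma standing_wave_force:
  assumes \<rho>s: "\<rho>s \<in> open_prob_simplex"
    and sol: "gnls_wave_solution {0..} h E \<omega> V W
      (\<lambda>t. \<chi> j. of_real (sqrt (\<rho>s $ j)) * exp (- (\<i> * of_real (\<nu> * t))))"
  shows "force V \<rho>s 0 j = h * \<nu>"
proof -
  from sol obtain \<rho> S where gs: "gnls_solution {0..} h E \<omega> V W \<rho> S"
    and eq: "\<And>t. t \<ge> 0 \<Longrightarrow> (\<chi> j. of_real (sqrt (\<rho>s $ j)) * exp (- (\<i> * of_real (\<nu> * t)))) = wave h (\<rho> t) (S t)"
    unfolding gnls_wave_solution_def by auto
  have pos: "\<rho>s $ j > 0" for j using \<rho>s by (simp add: open_prob_simplex_def)
  have comp: "of_real (sqrt (\<rho>s $ j)) * cis (- (\<nu> * t)) = of_real (sqrt (\<rho> t $ j)) * cis (S t $ j / h)" if "t \<ge> 0" for t j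
    using eq[OF that] by (simp add: wave_def vec_eq_iff cis_conv_exp)
  have \<rho>: "\<rho> t $ j = \<rho>s $ j" if "t \<ge> 0" for t j
  proof -
    have "cmod (of_real (sqrt (\<rho>s $ j)) * cis (- (\<nu> * t))) = cmod (of_real (sqrt (\<rho> t $ j)) * cis (S t $ j / h))"
      using comp[OF that] by simp
    then show ?thesis using pos[of j] gs that by (simp add: norm_mult gnls_solution_iff less_imp_le)
  qed
  have cis: "cis (S t $ j / h) = cis (- (\<nu> * t))" if "t \<ge> 0" for t j
    using comp[OF that, of j] \<rho>[OF that, of j] pos[of j] by simp
  have cos: "cos (S t $ j / h) = cos (\<nu> * t)" and sin: "sin (S t $ j / h) = - sin (\<nu> * t)" if "t \<ge> 0" for t j
    using arg_cong[OF cis[OF that, of j], of Re] arg_cong[OF cis[OF that, of j], of Im] by simp_all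
  \<comment> \<open>Time 1 is an arbitrary interior point of the half-line, chosen to have two-sided
    derivatives.\<close>
  have within: "at 1 within {0..} = at (1 :: real)"
    by (rule at_within_interior) simp
  have d\<rho>: "((\<lambda>s. \<rho> s $ j) has_real_derivative flux (\<rho> 1) (S 1) j) (at 1)"
    and dS: "((\<lambda>s. S s $ j) has_real_derivative - force V (\<rho> 1) (S 1) j) (at 1)" for j
    using bspec[OF gs[unfolded gnls_solution_iff], of 1] unfolding within by auto
  have unique: "D = D'" if "(f has_real_derivative D) (at 1)" "(g has_real_derivative D') (at 1)"
      "\<And>t. t \<ge> 0 \<Longrightarrow> f t = g t" for f g D D'
    using DERIV_unique[OF has_field_derivative_transform_within_open[OF that(1), of "{0<..}" g] that(2)] that(3) by simp
  have \<rho>1: "\<rho> 1 = \<rho>s" using \<rho> by (simp add: vec_eq_iff)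
  have flux: "flux \<rho>s (S 1) j = 0" for j
    using unique[OF d\<rho>[of j] DERIV_const[of "\<rho>s $ j"]] \<rho> \<rho>1 by simp
  define D where "D = - force V \<rho>s (S 1) j"
  have dS': "((\<lambda>s. S s $ j / h) has_real_derivative D / h) (at 1)"
    using DERIV_cdivide[OF dS, of j h] unfolding D_def \<rho>1 .
  have "((\<lambda>t. cos (\<nu> * t)) has_real_derivative - sin \<nu> * \<nu>) (at 1)"
    by (auto intro!: derivative_eq_intros)
  from unique[OF DERIV_chain2[OF DERIV_cos dS'] this cos]
  have 1: "sin \<nu> * (D / h) = - (sin \<nu> * \<nu>)" using sin[of 1 j] by simp
  have "((\<lambda>t. - sin (\<nu> * t)) has_real_derivative - (cos \<nu> * \<nu>)) (at 1)"
    by (auto intro!: derivative_eq_intros)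
  from unique[OF DERIV_chain2[OF DERIV_sin dS'] this sin]
  have 2: "cos \<nu> * (D / h) = - (cos \<nu> * \<nu>)" using cos[of 1 j] by simp
  \<comment> \<open>Each of the two equations may degenerate, but sine and cosine have no common
    zero.\<close>
  have "sin \<nu> \<noteq> 0 \<or> cos \<nu> \<noteq> 0" using sin_cos_squared_add[of \<nu>] by fastforce
  then have "D / h = - \<nu>" using 1 2 by (metis mult_cancel_left mult_minus_right)
  then have "force V \<rho>s (S 1) j = h * \<nu>" using h_pos unfolding D_def by (simp add: field_simps)
  then show ?thesis using force_eq_if_flux_zero[OF pos flux] by simp
qed

text \<open>The multiplier of the mass constraint is h \<nu>. Averaging the equal partial
  derivatives with the weights \<rho>s, which sum to 1, yields the formula through Euler's
  identity.\<close>

lemma standing_wave_critical: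
  assumes \<rho>s: "\<rho>s \<in> open_prob_simplex"
    and sol: "gnls_wave_solution {0..} h E \<omega> V W
      (\<lambda>t. \<chi> j. of_real (sqrt (\<rho>s $ j)) * exp (- (\<i> * of_real (\<nu> * t))))"
  shows "critical_point_on_simplex (sqrt_energy h E \<omega> V W) \<rho>s"
    and "h * \<nu> = sqrt_energy h E \<omega> V W \<rho>s + interaction_energy W (sqrt_state \<rho>s)"
proof -
  have pos: "\<rho>s $ j > 0" and sum: "(\<Sum>j\<in>UNIV. \<rho>s $ j) = 1" for j
    using \<rho>s by (auto simp: open_prob_simplex_def)
  have "((\<lambda>s. sqrt_energy h E \<omega> V W (\<rho>s + s *\<^sub>R axis j 1)) has_real_derivative h * \<nu> + 0) (at 0)" for j
    using sqrt_energy_partial_derivative[OF pos, where V=V] standing_wave_force[OF \<rho>s sol] by simp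
  then show "critical_point_on_simplex (sqrt_energy h E \<omega> V W) \<rho>s"
    unfolding critical_point_on_simplex_def prob_simplex_def using pos sum
    by (auto simp: less_imp_le intro!: exI[of _ "h * \<nu>"] exI[of _ "\<lambda>_. 0"])
  have "h * \<nu> = (\<Sum>j\<in>UNIV. force V \<rho>s 0 j * \<rho>s $ j)"
    using sum standing_wave_force[OF \<rho>s sol] by (simp flip: sum_distrib_left)
  then show "h * \<nu> = sqrt_energy h E \<omega> V W \<rho>s + interaction_energy W (sqrt_state \<rho>s)"
    by (simp add: force_euler[OF pos] sqrt_energy_eq_hamiltonian[OF pos])
qed

lemma gnls_solution_properties:
  assumes \<rho>0: "\<rho>0 \<in> open_prob_simplex"
  shows "\<exists>\<rho> S. unique_gnls_solution {0..} h E \<omega> V W \<rho>0 S0 \<rho> S \<and>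
    (\<forall>t\<ge>0. (\<Sum>j\<in>UNIV. (cmod (wave h (\<rho> t) (S t) $ j))\<^sup>2) = 1) \<and>
    (\<forall>t\<ge>0. total_energy h E \<omega> V W (log_wave h (\<rho> t) (S t)) (wave h (\<rho> t) (S t))
            = total_energy h E \<omega> V W (log_wave h \<rho>0 S0) (wave h \<rho>0 S0)) \<and>
    (\<exists>\<rho>' S'. unique_gnls_solution {..0} h E \<omega> V W \<rho>0 (- S0) \<rho>' S' \<and>
       (\<forall>t\<ge>0. \<forall>j. wave h (\<rho> t) (S t) $ j = cnj (wave h (\<rho>' (- t)) (S' (- t)) $ j))) \<and>
    (\<forall>\<alpha>. \<exists>\<rho>\<alpha> S\<alpha>. unique_gnls_solution {0..} h E \<omega> (\<chi> j. V $ j + \<alpha>) W \<rho>0 S0 \<rho>\<alpha> S\<alpha> \<and>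
       (\<forall>t\<ge>0. \<forall>j. wave h (\<rho>\<alpha> t) (S\<alpha> t) $ j
                   = wave h (\<rho> t) (S t) $ j * exp (- (\<i> * of_real (\<alpha> * t / h)))))"
proof -
  obtain \<rho> S where u: "unique_gnls_solution {0..} h E \<omega> V W \<rho>0 S0 \<rho> S"
    using gnls_solution_exists[OF \<rho>0] by blast
  then have sol: "gnls_solution {0..} h E \<omega> V W \<rho> S" and init: "\<rho> 0 = \<rho>0" "S 0 = S0"
    by (auto simp: unique_gnls_solution_def)
  have pos: "\<rho> t $ j > 0" if "t \<ge> 0" for t j using sol that by (simp add: gnls_solution_iff)
  have mass: "(\<Sum>j\<in>UNIV. (cmod (wave h (\<rho> t) (S t) $ j))\<^sup>2) = 1" if "t \<ge> 0" for t
  proof -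
    have "(\<Sum>j\<in>UNIV. (cmod (wave h (\<rho> t) (S t) $ j))\<^sup>2) = (\<Sum>j\<in>UNIV. \<rho> t $ j)"
      using pos[OF that] by (simp add: wave_def norm_mult less_imp_le)
    also have "\<dots> = 1" using gnls_mass[OF sol, of t] that \<rho>0 init by (simp add: open_prob_simplex_def)
    finally show ?thesis .
  qed
  have energy: "total_energy h E \<omega> V W (log_wave h (\<rho> t) (S t)) (wave h (\<rho> t) (S t))
      = total_energy h E \<omega> V W (log_wave h \<rho>0 S0) (wave h \<rho>0 S0)" if "t \<ge> 0" for t
  proof -
    have "\<rho>0 $ j > 0" for j using \<rho>0 by (simp add: open_prob_simplex_def)
    then show ?thesis
      using gnls_energy[OF sol, of t] that init pos[OF that] by (simp add: total_energy_eq_hamiltonian)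
  qed
  have "uminus ` {0..} = {..0::real}" by simp
  with unique_gnls_solution_reverse[OF u]
  have "unique_gnls_solution {..0} h E \<omega> V W \<rho>0 (- S0) (\<lambda>t. \<rho> (- t)) (\<lambda>t. - S (- t))" by simp
  moreover have "wave h (\<rho> t) (S t) $ j = cnj (wave h (\<rho> (- (- t))) (- S (- (- t))) $ j)" for t j
    by (simp add: wave_def exp_cnj)
  ultimately have rev: "\<exists>\<rho>' S'. unique_gnls_solution {..0} h E \<omega> V W \<rho>0 (- S0) \<rho>' S' \<and>
       (\<forall>t\<ge>0. \<forall>j. wave h (\<rho> t) (S t) $ j = cnj (wave h (\<rho>' (- t)) (S' (- t)) $ j))" by blast
  have "wave h (\<rho> t) (\<chi> j. S t $ j - \<alpha> * t) $ j = wave h (\<rho> t) (S t) $ j * exp (- (\<i> * of_real (\<alpha> * t / h)))" for \<alpha> t j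
  proof -
    have "\<i> * of_real ((S t $ j - \<alpha> * t) / h) = \<i> * of_real (S t $ j / h) + - (\<i> * of_real (\<alpha> * t / h))"
      by (simp add: diff_divide_distrib right_diff_distrib)
    then show ?thesis by (simp only: wave_def vec_lambda_beta exp_add mult.assoc)
  qed
  then have gauge: "\<exists>\<rho>\<alpha> S\<alpha>. unique_gnls_solution {0..} h E \<omega> (\<chi> j. V $ j + \<alpha>) W \<rho>0 S0 \<rho>\<alpha> S\<alpha> \<and>
       (\<forall>t\<ge>0. \<forall>j. wave h (\<rho>\<alpha> t) (S\<alpha> t) $ j
                   = wave h (\<rho> t) (S t) $ j * exp (- (\<i> * of_real (\<alpha> * t / h))))" for \<alpha>
    using unique_gnls_solution_gauge[OF u, of \<alpha>] by blast
  show ?thesis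
    by (intro exI[of _ \<rho>] exI[of _ S] conjI allI impI u mass energy rev gauge)
qed

end

lemma wave_density_exists:
  assumes "h > 0"
  shows "\<exists>S0. wave h (density \<Psi>) S0 = \<Psi>"
proof (rule exI[of _ "\<chi> j. h * Arg (\<Psi> $ j)"])
  have "wave h (density \<Psi>) (\<chi> j. h * Arg (\<Psi> $ j)) $ j = \<Psi> $ j" for j
    using assms rcis_cmod_Arg[of "\<Psi> $ j"]
    by (simp add: wave_def density_def rcis_def cis_conv_exp)
  then show "wave h (density \<Psi>) (\<chi> j. h * Arg (\<Psi> $ j)) = \<Psi>" by (simp add: vec_eq_iff)
qed

text \<open>\<open>\<Psi>0\<close> fixes the initial phase at each vertex only up to multiples of 2
  pi h. As phase differences enter as real numbers, different choices can lead to different energies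
  and evolutions, so the claims are made for every admissible \<open>S0\<close>; \<open>Arg\<close>
  provides one.\<close>

theorem theorem6:
  fixes E :: "('n::finite \<times> 'n) set" and \<omega> :: "'n \<Rightarrow> 'n \<Rightarrow> real"
    and V :: "real ^ 'n" and W :: "real ^ 'n ^ 'n" and h :: real and \<Psi>0 :: "complex ^ 'n"
  assumes "connected_weighted_graph E \<omega>"
    and "transpose W = W"
    and "h > 0"
    and "(\<Sum>j\<in>UNIV. (cmod (\<Psi>0 $ j))\<^sup>2) = 1"
    and "\<forall>j. cmod (\<Psi>0 $ j) > 0"
  shows
    "(\<exists>S0. wave h (density \<Psi>0) S0 = \<Psi>0) \<and>
     (\<forall>S0. wave h (density \<Psi>0) S0 = \<Psi>0 \<longrightarrow>
       (\<exists>\<rho> S. unique_gnls_solution {0..} h E \<omega> V W (density \<Psi>0) S0 \<rho> S \<and>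
          (\<forall>t\<ge>0. (\<Sum>j\<in>UNIV. (cmod (wave h (\<rho> t) (S t) $ j))\<^sup>2) = 1) \<and>
          (\<forall>t\<ge>0. total_energy h E \<omega> V W (log_wave h (\<rho> t) (S t)) (wave h (\<rho> t) (S t))
                  = total_energy h E \<omega> V W (log_wave h (density \<Psi>0) S0) \<Psi>0) \<and>
          (\<exists>\<rho>' S'. unique_gnls_solution {..0} h E \<omega> V W (density \<Psi>0) (- S0) \<rho>' S' \<and>
             (\<forall>t\<ge>0. \<forall>j. wave h (\<rho> t) (S t) $ j = cnj (wave h (\<rho>' (- t)) (S' (- t)) $ j))) \<and>
          (\<forall>\<alpha>. \<exists>\<rho>\<alpha> S\<alpha>. unique_gnls_solution {0..} h E \<omega> (\<chi> j. V $ j + \<alpha>) W (density \<Psi>0) S0 \<rho>\<alpha> S\<alpha> \<and>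
             (\<forall>t\<ge>0. \<forall>j. wave h (\<rho>\<alpha> t) (S\<alpha> t) $ j
                         = wave h (\<rho> t) (S t) $ j * exp (- (\<i> * of_real (\<alpha> * t / h))))))) \<and>
     (\<forall>\<nu> \<rho>s. \<rho>s \<in> open_prob_simplex \<and>
        gnls_wave_solution {0..} h E \<omega> V W
          (\<lambda>t. \<chi> j. of_real (sqrt (\<rho>s $ j)) * exp (- (\<i> * of_real (\<nu> * t)))) \<longrightarrow>
        critical_point_on_simplex (sqrt_energy h E \<omega> V W) \<rho>s \<and>
        h * \<nu> = sqrt_energy h E \<omega> V W \<rho>s + interaction_energy W (sqrt_state \<rho>s))"
proof -
  interpret gnls_graph E \<omega> W h by (rule gnls_graph.intro) (fact assms)+
  have simplex: "density \<Psi>0 \<in> open_prob_simplex"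
    using assms(4,5) by (simp add: open_prob_simplex_def density_def)
  show ?thesis
  proof (intro conjI allI impI)
    show "\<exists>S0. wave h (density \<Psi>0) S0 = \<Psi>0" by (rule wave_density_exists[OF assms(3)])
  next
    fix S0 assume S0: "wave h (density \<Psi>0) S0 = \<Psi>0"
    show "\<exists>\<rho> S. unique_gnls_solution {0..} h E \<omega> V W (density \<Psi>0) S0 \<rho> S \<and>
          (\<forall>t\<ge>0. (\<Sum>j\<in>UNIV. (cmod (wave h (\<rho> t) (S t) $ j))\<^sup>2) = 1) \<and>
          (\<forall>t\<ge>0. total_energy h E \<omega> V W (log_wave h (\<rho> t) (S t)) (wave h (\<rho> t) (S t))
                  = total_energy h E \<omega> V W (log_wave h (density \<Psi>0) S0) \<Psi>0) \<and>
          (\<exists>\<rho>' S'. unique_gnls_solution {..0} h E \<omega> V W (density \<Psi>0) (- S0) \<rho>' S' \<and>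
             (\<forall>t\<ge>0. \<forall>j. wave h (\<rho> t) (S t) $ j = cnj (wave h (\<rho>' (- t)) (S' (- t)) $ j))) \<and>
          (\<forall>\<alpha>. \<exists>\<rho>\<alpha> S\<alpha>. unique_gnls_solution {0..} h E \<omega> (\<chi> j. V $ j + \<alpha>) W (density \<Psi>0) S0 \<rho>\<alpha> S\<alpha> \<and>
             (\<forall>t\<ge>0. \<forall>j. wave h (\<rho>\<alpha> t) (S\<alpha> t) $ j
                         = wave h (\<rho> t) (S t) $ j * exp (- (\<i> * of_real (\<alpha> * t / h)))))"
      using gnls_solution_properties[OF simplex, of V S0, unfolded S0] .
  qed (use standing_wave_critical in blast)+
qed

end
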